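(* Let $k$ be a field, let $A$ be a fixed $k$-algebra, and let $\mathcal{E}$ be the set of all nearly Frobenius coproducts $\Delta : A \to A\otimes A$, i.e. of all $k$-linear maps that make $A$ into a nearly Frobenius algebra. Then $\mathcal{E}$ is a $k$-vector space (under pointwise addition and scalar multiplication of linear maps $A\to A\otimes A$).
   Context: Algebras are associative and unital over the field $k$, with multiplication $m:A\otimes A\to A$; $\otimes=\otimes_k$. A nearly Frobenius coproduct on $A$ is a $k$-linear map $\Delta:A\to A\otimes A$ such that (1) $\Delta$ is coassociative: $(\Delta\otimes 1)\circ\Delta=(1\otimes\Delta)\circ\Delta$; and (2) $\Delta$ is a morphism of $A$-bimodules: $\Delta\circ m=(1\otimes m)\circ(\Delta\otimes 1)$ and $\Delta\circ m=(m\otimes 1)\circ(1\otimes\Delta)$. A nearly Frobenius algebra is an algebra $A$ for which such a $\Delta$ exists (equivalently, is given). No counit is required. *)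

theory Defs
  imports "HOL-Algebra.Module" "HOL-Algebra.AbelCoset"
begin

section \<open>Vector spaces, algebras and linear maps\<close>

locale vectorspace = field K + module K V for K (structure) and V (structure)

text \<open>The locale \<^locale>\<open>algebra\<close> of the library requires commutativity.\<close>

locale assoc_algebra = field K + ring A + module K A for K (structure) and A (structure) +
  assumes smult_mult_left:
      "\<lbrakk>c \<in> carrier K; x \<in> carrier A; y \<in> carrier A\<rbrakk> \<Longrightarrow>
        (c \<odot>\<^bsub>A\<^esub> x) \<otimes>\<^bsub>A\<^esub> y = c \<odot>\<^bsub>A\<^esub> (x \<otimes>\<^bsub>A\<^esub> y)"
    and smult_mult_right:
      "\<lbrakk>c \<in> carrier K; x \<in> carrier A; y \<in> carrier A\<rbrakk> \<Longrightarrow>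
        x \<otimes>\<^bsub>A\<^esub> (c \<odot>\<^bsub>A\<^esub> y) = c \<odot>\<^bsub>A\<^esub> (x \<otimes>\<^bsub>A\<^esub> y)"

text \<open>Linear maps are extensional (fixed to the value \<^const>\<open>undefined\<close> off the carrier), so that
  equality of functions is equality of linear maps.\<close>

definition linear_maps ::
    "('k, 'm) ring_scheme \<Rightarrow> ('k, 'v, 'p) module_scheme \<Rightarrow> ('k, 'w, 'q) module_scheme \<Rightarrow> ('v \<Rightarrow> 'w) set"
  where "linear_maps K V W =
    {f \<in> carrier V \<rightarrow>\<^sub>E carrier W.
       (\<forall>x\<in>carrier V. \<forall>y\<in>carrier V. f (x \<oplus>\<^bsub>V\<^esub> y) = f x \<oplus>\<^bsub>W\<^esub> f y) \<and>
       (\<forall>c\<in>carrier K. \<forall>x\<in>carrier V. f (c \<odot>\<^bsub>V\<^esub> x) = c \<odot>\<^bsub>W\<^esub> f x)}"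

text \<open>The \<^const>\<open>mult\<close> and \<^const>\<open>one\<close> fields of a \<^type>\<open>module\<close> record are irrelevant to the
  module structure.\<close>

definition hom_module ::
    "('k, 'm) ring_scheme \<Rightarrow> ('k, 'v, 'p) module_scheme \<Rightarrow> ('k, 'w, 'q) module_scheme
      \<Rightarrow> ('k, 'v \<Rightarrow> 'w) module"
  where "hom_module K V W =
    \<lparr>carrier = linear_maps K V W, mult = undefined, one = undefined,
     zero = (\<lambda>x\<in>carrier V. \<zero>\<^bsub>W\<^esub>),
     add = (\<lambda>f g. \<lambda>x\<in>carrier V. f x \<oplus>\<^bsub>W\<^esub> g x),
     smult = (\<lambda>c f. \<lambda>x\<in>carrier V. c \<odot>\<^bsub>W\<^esub> f x)\<rparr>"

section \<open>Tensor products\<close>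

text \<open>The free module on \<^term>\<open>S\<close>: finitely supported functions, zero off \<^term>\<open>S\<close>.\<close>

definition free_module :: "('k, 'm) ring_scheme \<Rightarrow> 's set \<Rightarrow> ('k, 's \<Rightarrow> 'k) module"
  where "free_module K S =
    \<lparr>carrier = {f. range f \<subseteq> carrier K \<and> finite {s. f s \<noteq> \<zero>\<^bsub>K\<^esub>} \<and> {s. f s \<noteq> \<zero>\<^bsub>K\<^esub>} \<subseteq> S},
     mult = undefined, one = undefined,
     zero = (\<lambda>s. \<zero>\<^bsub>K\<^esub>),
     add = (\<lambda>f g s. f s \<oplus>\<^bsub>K\<^esub> g s),
     smult = (\<lambda>c f s. c \<otimes>\<^bsub>K\<^esub> f s)\<rparr>"

definition free_gen :: "('k, 'm) ring_scheme \<Rightarrow> 's \<Rightarrow> 's \<Rightarrow> 'k"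
  where "free_gen K s = (\<lambda>t. if t = s then \<one>\<^bsub>K\<^esub> else \<zero>\<^bsub>K\<^esub>)"

definition submodule_span ::
    "('k, 'm) ring_scheme \<Rightarrow> ('k, 'v, 'p) module_scheme \<Rightarrow> 'v set \<Rightarrow> 'v set"
  where "submodule_span K M B = \<Inter>{H. submodule H K M \<and> B \<subseteq> H}"

text \<open>In the scalar action, all \<^term>\<open>x \<in> X\<close> give the same coset; taking the coset again (rather
  than the image of \<^term>\<open>X\<close>) matters for the scalar zero.\<close>

definition quotient_module :: "('k, 'v, 'p) module_scheme \<Rightarrow> 'v set \<Rightarrow> ('k, 'v set) module"
  where "quotient_module M N =
    \<lparr>carrier = a_rcosets\<^bsub>M\<^esub> N, mult = undefined, one = undefined,
     zero = N,
     add = (\<lambda>X Y. X <+>\<^bsub>M\<^esub> Y),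
     smult = (\<lambda>c X. \<Union>x\<in>X. N +>\<^bsub>M\<^esub> (c \<odot>\<^bsub>M\<^esub> x))\<rparr>"

abbreviation tensor_free ::
    "('k, 'm) ring_scheme \<Rightarrow> ('k, 'v, 'p) module_scheme \<Rightarrow> ('k, 'w, 'q) module_scheme
      \<Rightarrow> ('k, 'v \<times> 'w \<Rightarrow> 'k) module"
  where "tensor_free K V W \<equiv> free_module K (carrier V \<times> carrier W)"

definition tensor_relators ::
    "('k, 'm) ring_scheme \<Rightarrow> ('k, 'v, 'p) module_scheme \<Rightarrow> ('k, 'w, 'q) module_scheme
      \<Rightarrow> ('v \<times> 'w \<Rightarrow> 'k) set"
  where "tensor_relators K V W =
    (let F = tensor_free K V W; d = (\<lambda>v w. free_gen K (v, w)) in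
      {d (v \<oplus>\<^bsub>V\<^esub> v') w \<ominus>\<^bsub>F\<^esub> (d v w \<oplus>\<^bsub>F\<^esub> d v' w) |v v' w.
         v \<in> carrier V \<and> v' \<in> carrier V \<and> w \<in> carrier W} \<union>
      {d v (w \<oplus>\<^bsub>W\<^esub> w') \<ominus>\<^bsub>F\<^esub> (d v w \<oplus>\<^bsub>F\<^esub> d v w') |v w w'.
         v \<in> carrier V \<and> w \<in> carrier W \<and> w' \<in> carrier W} \<union>
      {d (c \<odot>\<^bsub>V\<^esub> v) w \<ominus>\<^bsub>F\<^esub> c \<odot>\<^bsub>F\<^esub> d v w |c v w.
         c \<in> carrier K \<and> v \<in> carrier V \<and> w \<in> carrier W} \<union>
      {d v (c \<odot>\<^bsub>W\<^esub> w) \<ominus>\<^bsub>F\<^esub> c \<odot>\<^bsub>F\<^esub> d v w |c v w.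
         c \<in> carrier K \<and> v \<in> carrier V \<and> w \<in> carrier W})"

definition tensor_null ::
    "('k, 'm) ring_scheme \<Rightarrow> ('k, 'v, 'p) module_scheme \<Rightarrow> ('k, 'w, 'q) module_scheme
      \<Rightarrow> ('v \<times> 'w \<Rightarrow> 'k) set"
  where "tensor_null K V W = submodule_span K (tensor_free K V W) (tensor_relators K V W)"

definition tensor ::
    "('k, 'm) ring_scheme \<Rightarrow> ('k, 'v, 'p) module_scheme \<Rightarrow> ('k, 'w, 'q) module_scheme
      \<Rightarrow> ('k, ('v \<times> 'w \<Rightarrow> 'k) set) module"
  where "tensor K V W = quotient_module (tensor_free K V W) (tensor_null K V W)"

definition pure_tensor ::
    "('k, 'm) ring_scheme \<Rightarrow> ('k, 'v, 'p) module_scheme \<Rightarrow> ('k, 'w, 'q) module_scheme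
      \<Rightarrow> 'v \<Rightarrow> 'w \<Rightarrow> ('v \<times> 'w \<Rightarrow> 'k) set"
  where "pure_tensor K V W v w = tensor_null K V W +>\<^bsub>tensor_free K V W\<^esub> free_gen K (v, w)"

definition bilinear_map ::
    "('k, 'm) ring_scheme \<Rightarrow> ('k, 'v, 'p) module_scheme \<Rightarrow> ('k, 'w, 'q) module_scheme
      \<Rightarrow> ('k, 'u, 'r) module_scheme \<Rightarrow> ('v \<Rightarrow> 'w \<Rightarrow> 'u) \<Rightarrow> bool"
  where "bilinear_map K V W U b \<longleftrightarrow>
    (\<forall>v\<in>carrier V. \<forall>w\<in>carrier W. b v w \<in> carrier U) \<and>
    (\<forall>v\<in>carrier V. \<forall>v'\<in>carrier V. \<forall>w\<in>carrier W. b (v \<oplus>\<^bsub>V\<^esub> v') w = b v w \<oplus>\<^bsub>U\<^esub> b v' w) \<and>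
    (\<forall>v\<in>carrier V. \<forall>w\<in>carrier W. \<forall>w'\<in>carrier W. b v (w \<oplus>\<^bsub>W\<^esub> w') = b v w \<oplus>\<^bsub>U\<^esub> b v w') \<and>
    (\<forall>c\<in>carrier K. \<forall>v\<in>carrier V. \<forall>w\<in>carrier W. b (c \<odot>\<^bsub>V\<^esub> v) w = c \<odot>\<^bsub>U\<^esub> b v w) \<and>
    (\<forall>c\<in>carrier K. \<forall>v\<in>carrier V. \<forall>w\<in>carrier W. b v (c \<odot>\<^bsub>W\<^esub> w) = c \<odot>\<^bsub>U\<^esub> b v w)"

subsection \<open>The universal property\<close>

lemma free_module_simps [simp]:
  "f \<in> carrier (free_module K S) \<longleftrightarrow>
     range f \<subseteq> carrier K \<and> finite {s. f s \<noteq> \<zero>\<^bsub>K\<^esub>} \<and> {s. f s \<noteq> \<zero>\<^bsub>K\<^esub>} \<subseteq> S"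
  "\<zero>\<^bsub>free_module K S\<^esub> = (\<lambda>s. \<zero>\<^bsub>K\<^esub>)"
  "f \<oplus>\<^bsub>free_module K S\<^esub> g = (\<lambda>s. f s \<oplus>\<^bsub>K\<^esub> g s)"
  "c \<odot>\<^bsub>free_module K S\<^esub> f = (\<lambda>s. c \<otimes>\<^bsub>K\<^esub> f s)"
  by (auto simp: free_module_def)

lemma (in cring) free_module_module: "module R (free_module R S)"
proof -
  let ?F = "free_module R S"
  have cl: "f s \<in> carrier R" if "f \<in> carrier ?F" for f s
    using that by auto
  have add: "f \<oplus>\<^bsub>?F\<^esub> g \<in> carrier ?F" if f: "f \<in> carrier ?F" and g: "g \<in> carrier ?F" for f g
  proof -
    have sub: "{s. f s \<oplus> g s \<noteq> \<zero>} \<subseteq> {s. f s \<noteq> \<zero>} \<union> {s. g s \<noteq> \<zero>}" by auto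
    have "finite {s. f s \<oplus> g s \<noteq> \<zero>}"
      by (rule finite_subset[OF sub]) (use f g in simp)
    moreover have "{s. f s \<oplus> g s \<noteq> \<zero>} \<subseteq> S" using sub f g by (auto simp: subset_iff)
    ultimately show ?thesis using cl[OF f] cl[OF g] by auto
  qed
  have scl: "c \<odot>\<^bsub>?F\<^esub> f \<in> carrier ?F" if c: "c \<in> carrier R" and f: "f \<in> carrier ?F" for c f
  proof -
    have sub: "{s. c \<otimes> f s \<noteq> \<zero>} \<subseteq> {s. f s \<noteq> \<zero>}" using c by auto
    have "finite {s. c \<otimes> f s \<noteq> \<zero>}"
      by (rule finite_subset[OF sub]) (use f in simp)
    moreover have "{s. c \<otimes> f s \<noteq> \<zero>} \<subseteq> S" using sub f by (auto simp: subset_iff)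
    ultimately show ?thesis using c cl[OF f] by auto
  qed
  have inv: "\<exists>g \<in> carrier ?F. g \<oplus>\<^bsub>?F\<^esub> f = \<zero>\<^bsub>?F\<^esub>" if f: "f \<in> carrier ?F" for f
  proof (rule bexI)
    have "\<ominus> \<one> \<otimes> f s \<oplus> f s = \<zero>" for s
      using cl[OF f, of s] by (simp add: l_minus l_neg)
    then show "((\<ominus> \<one>) \<odot>\<^bsub>?F\<^esub> f) \<oplus>\<^bsub>?F\<^esub> f = \<zero>\<^bsub>?F\<^esub>" by simp
    show "(\<ominus> \<one>) \<odot>\<^bsub>?F\<^esub> f \<in> carrier ?F" using f by (intro scl) auto
  qed
  show ?thesis
  proof (rule moduleI)
    show "abelian_group ?F"
    proof (rule abelian_groupI)
      show "\<zero>\<^bsub>?F\<^esub> \<in> carrier ?F" by auto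
    next
      fix f g h assume "f \<in> carrier ?F" "g \<in> carrier ?F" "h \<in> carrier ?F"
      note c = this[THEN cl]
      show "f \<oplus>\<^bsub>?F\<^esub> g \<oplus>\<^bsub>?F\<^esub> h = f \<oplus>\<^bsub>?F\<^esub> (g \<oplus>\<^bsub>?F\<^esub> h)"
        using c by (simp add: a_assoc)
    next
      fix f g assume "f \<in> carrier ?F" "g \<in> carrier ?F"
      note c = this[THEN cl]
      show "f \<oplus>\<^bsub>?F\<^esub> g = g \<oplus>\<^bsub>?F\<^esub> f" using c by (simp add: a_comm)
    next
      fix f assume "f \<in> carrier ?F"
      note c = this[THEN cl]
      show "\<zero>\<^bsub>?F\<^esub> \<oplus>\<^bsub>?F\<^esub> f = f" using c by simp
    qed (fact add, fact inv)
  next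
    fix a b f assume "a \<in> carrier R" "b \<in> carrier R" and f: "f \<in> carrier ?F"
    then show "(a \<oplus> b) \<odot>\<^bsub>?F\<^esub> f = (a \<odot>\<^bsub>?F\<^esub> f) \<oplus>\<^bsub>?F\<^esub> (b \<odot>\<^bsub>?F\<^esub> f)"
      "(a \<otimes> b) \<odot>\<^bsub>?F\<^esub> f = a \<odot>\<^bsub>?F\<^esub> (b \<odot>\<^bsub>?F\<^esub> f)"
      using cl[OF f] by (simp_all add: l_distr m_assoc)
  next
    fix a f g assume "a \<in> carrier R" and f: "f \<in> carrier ?F" and g: "g \<in> carrier ?F"
    then show "a \<odot>\<^bsub>?F\<^esub> (f \<oplus>\<^bsub>?F\<^esub> g) = (a \<odot>\<^bsub>?F\<^esub> f) \<oplus>\<^bsub>?F\<^esub> (a \<odot>\<^bsub>?F\<^esub> g)"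
      using cl[OF f] cl[OF g] by (simp add: r_distr)
  next
    fix f assume f: "f \<in> carrier ?F"
    show "\<one> \<odot>\<^bsub>?F\<^esub> f = f" using cl[OF f] by simp
  qed (fact cring_axioms, fact scl)
qed

lemma (in cring) free_gen_closed: "s \<in> S \<Longrightarrow> free_gen R s \<in> carrier (free_module R S)"
proof -
  assume "s \<in> S"
  moreover have "finite {t. free_gen R s t \<noteq> \<zero>}"
    by (rule finite_subset[of _ "{s}"]) (auto simp: free_gen_def)
  ultimately show ?thesis by (auto simp: free_gen_def)
qed

lemma (in cring) free_module_span:
  assumes H: "submodule H R (free_module R S)" and gen: "\<And>s. s \<in> S \<Longrightarrow> free_gen R s \<in> H"
    and f: "f \<in> carrier (free_module R S)"
  shows "f \<in> H"
proof -
  let ?F = "free_module R S"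
  interpret F: module R ?F by (rule free_module_module)
  note HE = F.submoduleE[OF H]
  have "f \<in> carrier ?F \<Longrightarrow> {s. f s \<noteq> \<zero>} \<subseteq> T \<Longrightarrow> f \<in> H" if "finite T" for T f
    using that
  proof (induction T arbitrary: f rule: finite_induct)
    case empty
    then have "f = \<zero>\<^bsub>?F\<^esub>" by auto
    moreover obtain h where "h \<in> H" using HE(2) by auto
    then have "\<zero> \<odot>\<^bsub>?F\<^esub> h \<in> H" "h \<in> carrier ?F" using HE(4)[OF zero_closed] HE(1) by blast+
    then have "\<zero>\<^bsub>?F\<^esub> \<in> H" using F.smult_l_null by metis
    ultimately show ?case by simp
  next
    case (insert t T)
    show ?case
    proof (cases "t \<in> S")
      case False
      then have "{s. f s \<noteq> \<zero>} \<subseteq> T" using insert.prems by auto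
      then show ?thesis using insert by blast
    next
      case True
      define g where "g = f(t := \<zero>)"
      have cl: "f s \<in> carrier R" for s using insert.prems(1) by auto
      have supp: "{s. g s \<noteq> \<zero>} \<subseteq> {s. f s \<noteq> \<zero>}" "{s. g s \<noteq> \<zero>} \<subseteq> T"
        using insert.prems(2) by (auto simp: g_def)
      have "finite {s. g s \<noteq> \<zero>}"
        by (rule finite_subset[OF supp(1)]) (use insert.prems(1) in simp)
      then have "g \<in> carrier ?F"
        using insert.prems(1) supp(1) by (auto simp: g_def)
      then have "g \<in> H" using insert.IH supp(2) by blast
      moreover have "f t \<odot>\<^bsub>?F\<^esub> free_gen R t \<in> H"
        using HE(4)[OF cl gen[OF True]] .
      moreover have "f = g \<oplus>\<^bsub>?F\<^esub> (f t \<odot>\<^bsub>?F\<^esub> free_gen R t)"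
        using cl by (auto simp: g_def free_gen_def fun_eq_iff)
      ultimately show ?thesis using HE(5) by metis
    qed
  qed
  from this[OF _ f subset_refl] show ?thesis using f by simp
qed

lemma (in module) submodule_span_submodule:
  assumes "B \<subseteq> carrier M"
  shows "submodule (submodule_span R M B) R M"
proof -
  let ?C = "{H. submodule H R M \<and> B \<subseteq> H}"
  have mem: "carrier M \<in> ?C" using carrier_is_submodule assms by blast
  show ?thesis unfolding submodule_span_def
  proof (rule submoduleI)
    show "\<Inter>?C \<subseteq> carrier M" using mem by blast
    show "\<zero>\<^bsub>M\<^esub> \<in> \<Inter>?C"
      using subgroup.one_closed[OF submodule.axioms(1)] by fastforce
    fix a assume a: "a \<in> \<Inter>?C"
    show "\<ominus>\<^bsub>M\<^esub> a \<in> \<Inter>?C"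
    proof
      fix H assume H: "H \<in> ?C"
      then have s: "submodule H R M" by blast
      show "\<ominus>\<^bsub>M\<^esub> a \<in> H" by (rule submoduleE(3)[OF s InterD[OF a H]])
    qed
    fix b assume b: "b \<in> \<Inter>?C"
    show "a \<oplus>\<^bsub>M\<^esub> b \<in> \<Inter>?C"
    proof
      fix H assume H: "H \<in> ?C"
      then have s: "submodule H R M" by blast
      show "a \<oplus>\<^bsub>M\<^esub> b \<in> H" by (rule submoduleE(5)[OF s InterD[OF a H] InterD[OF b H]])
    qed
  next
    fix c a assume c: "c \<in> carrier R" and a: "a \<in> \<Inter>?C"
    show "c \<odot>\<^bsub>M\<^esub> a \<in> \<Inter>?C"
    proof
      fix H assume H: "H \<in> ?C"
      then have s: "submodule H R M" by blast
      show "c \<odot>\<^bsub>M\<^esub> a \<in> H" by (rule submoduleE(4)[OF s c InterD[OF a H]])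
    qed
  qed
qed

context module
begin

lemma quotient_abelian_subgroup: "submodule N R M \<Longrightarrow> abelian_subgroup N M"
  by (rule abelian_subgroupI3)
    (auto intro: additive_subgroup.intro submodule.axioms(1) simp: M.abelian_group_axioms)

lemma quotient_add:
  assumes "submodule N R M" "x \<in> carrier M" "y \<in> carrier M"
  shows "(N +>\<^bsub>M\<^esub> x) \<oplus>\<^bsub>quotient_module M N\<^esub> (N +>\<^bsub>M\<^esub> y) = N +>\<^bsub>M\<^esub> (x \<oplus>\<^bsub>M\<^esub> y)"
  using abelian_subgroup.a_rcos_sum[OF quotient_abelian_subgroup[OF assms(1)] assms(2,3)]
  by (simp add: quotient_module_def)

lemma quotient_eq_iff:
  assumes N: "submodule N R M" and "x \<in> carrier M" "y \<in> carrier M"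
  shows "N +>\<^bsub>M\<^esub> x = N +>\<^bsub>M\<^esub> y \<longleftrightarrow> x \<ominus>\<^bsub>M\<^esub> y \<in> N"
proof -
  interpret N: abelian_subgroup N M by (rule quotient_abelian_subgroup[OF N])
  have "x \<ominus>\<^bsub>M\<^esub> y \<in> N \<longleftrightarrow> x \<in> N +>\<^bsub>M\<^esub> y"
    using N.a_rcos_module assms by (metis a_minus_def)
  also have "\<dots> \<longleftrightarrow> N +>\<^bsub>M\<^esub> x = N +>\<^bsub>M\<^esub> y"
    using assms M.a_repr_independence'[folded a_r_coset_def, OF _ _ N.a_subgroup] N.a_rcos_self by metis
  finally show ?thesis by simp
qed

lemma quotient_smult:
  assumes N: "submodule N R M" and c: "c \<in> carrier R" and x: "x \<in> carrier M"
  shows "c \<odot>\<^bsub>quotient_module M N\<^esub> (N +>\<^bsub>M\<^esub> x) = N +>\<^bsub>M\<^esub> (c \<odot>\<^bsub>M\<^esub> x)"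
proof -
  interpret N: abelian_subgroup N M by (rule quotient_abelian_subgroup[OF N])
  have eq: "N +>\<^bsub>M\<^esub> (c \<odot>\<^bsub>M\<^esub> y) = N +>\<^bsub>M\<^esub> (c \<odot>\<^bsub>M\<^esub> x)" if y: "y \<in> N +>\<^bsub>M\<^esub> x" for y
  proof -
    have yM: "y \<in> carrier M" using y x N.a_elemrcos_carrier by blast
    have "y \<ominus>\<^bsub>M\<^esub> x \<in> N"
      using y x yM quotient_eq_iff[OF N yM x] M.a_repr_independence'[folded a_r_coset_def, OF _ _ N.a_subgroup] by metis
    then have "c \<odot>\<^bsub>M\<^esub> (y \<ominus>\<^bsub>M\<^esub> x) \<in> N" using submoduleE(4)[OF N] c by blast
    then have "(c \<odot>\<^bsub>M\<^esub> y) \<ominus>\<^bsub>M\<^esub> (c \<odot>\<^bsub>M\<^esub> x) \<in> N"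
      using c x yM by (simp add: a_minus_def smult_r_distr smult_r_minus)
    then show ?thesis using quotient_eq_iff[OF N] c x yM by simp
  qed
  have "x \<in> N +>\<^bsub>M\<^esub> x" using x by (rule N.a_rcos_self)
  then have "(\<Union>y\<in>N +>\<^bsub>M\<^esub> x. N +>\<^bsub>M\<^esub> (c \<odot>\<^bsub>M\<^esub> y)) = N +>\<^bsub>M\<^esub> (c \<odot>\<^bsub>M\<^esub> x)"
    by (intro SUP_eq_const eq) auto
  then show ?thesis by (simp add: quotient_module_def)
qed

lemma quotient_carrier: "carrier (quotient_module M N) = (\<lambda>x. N +>\<^bsub>M\<^esub> x) ` carrier M"
  by (auto simp: quotient_module_def A_RCOSETS_def')

lemma quotient_zero: "submodule N R M \<Longrightarrow> \<zero>\<^bsub>quotient_module M N\<^esub> = N +>\<^bsub>M\<^esub> \<zero>\<^bsub>M\<^esub>"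
  using submoduleE(1) by (simp add: quotient_module_def M.a_coset_add_zero)

lemma quotient_module_module:
  assumes N: "submodule N R M"
  shows "module R (quotient_module M N)"
proof -
  let ?Q = "quotient_module M N"
  note add = quotient_add[OF N] and smu = quotient_smult[OF N] and zero = quotient_zero[OF N]
  have cos: "N +>\<^bsub>M\<^esub> x \<in> carrier ?Q" if "x \<in> carrier M" for x
    unfolding quotient_carrier using that by (rule imageI)
  have rep: "\<exists>x. x \<in> carrier M \<and> X = N +>\<^bsub>M\<^esub> x" if "X \<in> carrier ?Q" for X
    using that unfolding quotient_carrier by blast
  show ?thesis
  proof (rule moduleI)
    show "abelian_group ?Q"
    proof (rule abelian_groupI)
      show "\<zero>\<^bsub>?Q\<^esub> \<in> carrier ?Q" unfolding zero by (rule cos[OF M.zero_closed])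
    next
      fix X assume "X \<in> carrier ?Q"
      then obtain x where x: "x \<in> carrier M" "X = N +>\<^bsub>M\<^esub> x" using rep by blast
      have "(N +>\<^bsub>M\<^esub> (\<ominus>\<^bsub>M\<^esub> x)) \<oplus>\<^bsub>?Q\<^esub> X = \<zero>\<^bsub>?Q\<^esub>"
        unfolding x(2) zero add[OF M.a_inv_closed[OF x(1)] x(1)] M.l_neg[OF x(1)] ..
      then show "\<exists>Y\<in>carrier ?Q. Y \<oplus>\<^bsub>?Q\<^esub> X = \<zero>\<^bsub>?Q\<^esub>"
        using cos[OF M.a_inv_closed[OF x(1)]] by blast
      show "\<zero>\<^bsub>?Q\<^esub> \<oplus>\<^bsub>?Q\<^esub> X = X"
        unfolding x(2) zero add[OF M.zero_closed x(1)] M.l_zero[OF x(1)] ..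
      fix Y assume "Y \<in> carrier ?Q"
      then obtain y where y: "y \<in> carrier M" "Y = N +>\<^bsub>M\<^esub> y" using rep by blast
      show "X \<oplus>\<^bsub>?Q\<^esub> Y \<in> carrier ?Q"
        unfolding x(2) y(2) add[OF x(1) y(1)] by (rule cos[OF M.a_closed[OF x(1) y(1)]])
      show "X \<oplus>\<^bsub>?Q\<^esub> Y = Y \<oplus>\<^bsub>?Q\<^esub> X"
        unfolding x(2) y(2) add[OF x(1) y(1)] add[OF y(1) x(1)] M.a_comm[OF x(1) y(1)] ..
      fix Z assume "Z \<in> carrier ?Q"
      then obtain z where z: "z \<in> carrier M" "Z = N +>\<^bsub>M\<^esub> z" using rep by blast
      show "X \<oplus>\<^bsub>?Q\<^esub> Y \<oplus>\<^bsub>?Q\<^esub> Z = X \<oplus>\<^bsub>?Q\<^esub> (Y \<oplus>\<^bsub>?Q\<^esub> Z)"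
        unfolding x(2) y(2) z(2) add[OF x(1) y(1)] add[OF y(1) z(1)]
          add[OF M.a_closed[OF x(1) y(1)] z(1)] add[OF x(1) M.a_closed[OF y(1) z(1)]]
          M.a_assoc[OF x(1) y(1) z(1)] ..
    qed
  next
    fix a X assume a: "a \<in> carrier R" and "X \<in> carrier ?Q"
    then obtain x where x: "x \<in> carrier M" "X = N +>\<^bsub>M\<^esub> x" using rep by blast
    note ax = smult_closed[OF a x(1)]
    show "a \<odot>\<^bsub>?Q\<^esub> X \<in> carrier ?Q" unfolding x(2) smu[OF a x(1)] by (rule cos[OF ax])
    fix b assume b: "b \<in> carrier R"
    note bx = smult_closed[OF b x(1)]
    show "(a \<oplus> b) \<odot>\<^bsub>?Q\<^esub> X = (a \<odot>\<^bsub>?Q\<^esub> X) \<oplus>\<^bsub>?Q\<^esub> (b \<odot>\<^bsub>?Q\<^esub> X)"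
      unfolding x(2) smu[OF a x(1)] smu[OF b x(1)] add[OF ax bx] smu[OF R.a_closed[OF a b] x(1)]
        smult_l_distr[OF a b x(1)] ..
    show "(a \<otimes> b) \<odot>\<^bsub>?Q\<^esub> X = a \<odot>\<^bsub>?Q\<^esub> (b \<odot>\<^bsub>?Q\<^esub> X)"
      unfolding x(2) smu[OF b x(1)] smu[OF a bx] smu[OF R.m_closed[OF a b] x(1)]
        smult_assoc1[OF a b x(1)] ..
  next
    fix a X Y assume a: "a \<in> carrier R" and "X \<in> carrier ?Q" "Y \<in> carrier ?Q"
    then obtain x y where x: "x \<in> carrier M" "X = N +>\<^bsub>M\<^esub> x" and y: "y \<in> carrier M" "Y = N +>\<^bsub>M\<^esub> y"
      using rep by metis
    show "a \<odot>\<^bsub>?Q\<^esub> (X \<oplus>\<^bsub>?Q\<^esub> Y) = (a \<odot>\<^bsub>?Q\<^esub> X) \<oplus>\<^bsub>?Q\<^esub> (a \<odot>\<^bsub>?Q\<^esub> Y)"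
      unfolding x(2) y(2) smu[OF a x(1)] smu[OF a y(1)] add[OF x(1) y(1)]
        add[OF smult_closed[OF a x(1)] smult_closed[OF a y(1)]]
        smu[OF a M.a_closed[OF x(1) y(1)]] smult_r_distr[OF a x(1) y(1)] ..
  next
    fix X assume "X \<in> carrier ?Q"
    then obtain x where x: "x \<in> carrier M" "X = N +>\<^bsub>M\<^esub> x" using rep by blast
    show "\<one> \<odot>\<^bsub>?Q\<^esub> X = X" unfolding x(2) smu[OF R.one_closed x(1)] smult_one[OF x(1)] ..
  qed (rule R.cring_axioms)
qed

end

context
  fixes K :: "('k, 'm) ring_scheme"
    and V :: "('k, 'v, 'p) module_scheme" and W :: "('k, 'w, 'q) module_scheme"
  assumes V: "module K V" and W: "module K W"
begin

interpretation V: module K V by (rule V)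
interpretation W: module K W by (rule W)
interpretation F: module K "tensor_free K V W" by (rule V.R.free_module_module)

lemma tensor_relators_closed: "tensor_relators K V W \<subseteq> carrier (tensor_free K V W)"
proof -
  have d: "free_gen K (v, w) \<in> carrier (tensor_free K V W)"
    if "v \<in> carrier V" "w \<in> carrier W" for v w
    using that by (intro V.R.free_gen_closed) simp
  show ?thesis
    unfolding tensor_relators_def Let_def
    by (intro Un_least subsetI; elim CollectE exE conjE; hypsubst;
        intro F.minus_closed F.a_closed F.smult_closed d V.a_closed W.a_closed V.smult_closed
          W.smult_closed; assumption)
qed

lemma tensor_null_submodule: "submodule (tensor_null K V W) K (tensor_free K V W)"
  unfolding tensor_null_def by (rule F.submodule_span_submodule[OF tensor_relators_closed])

lemma tensor_module: "module K (tensor K V W)"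
  unfolding tensor_def by (rule F.quotient_module_module[OF tensor_null_submodule])


lemma free_gen_in_free:
  "v \<in> carrier V \<Longrightarrow> w \<in> carrier W \<Longrightarrow> free_gen K (v, w) \<in> carrier (tensor_free K V W)"
  by (intro V.R.free_gen_closed) simp

lemma pure_tensor_closed:
  "v \<in> carrier V \<Longrightarrow> w \<in> carrier W \<Longrightarrow> pure_tensor K V W v w \<in> carrier (tensor K V W)"
  unfolding tensor_def pure_tensor_def F.quotient_carrier using free_gen_in_free by (rule imageI)

lemma pure_tensor_bilinear: "bilinear_map K V W (tensor K V W) (pure_tensor K V W)"
proof -
  let ?F = "tensor_free K V W" and ?N = "tensor_null K V W"
  note d = free_gen_in_free
  note N = tensor_null_submodule
  have rel: "tensor_relators K V W \<subseteq> ?N"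
    unfolding tensor_null_def submodule_span_def by blast
  have eqI: "?N +>\<^bsub>?F\<^esub> x = ?N +>\<^bsub>?F\<^esub> y"
    if "x \<in> carrier ?F" "y \<in> carrier ?F" "x \<ominus>\<^bsub>?F\<^esub> y \<in> tensor_relators K V W" for x y
    using F.quotient_eq_iff[OF N that(1,2)] that(3) rel by blast
  note q = F.quotient_add[OF N, symmetric] F.quotient_smult[OF N, symmetric]
  show ?thesis unfolding bilinear_map_def
  proof (intro conjI ballI)
    fix v v' w assume c: "v \<in> carrier V" "v' \<in> carrier V" "w \<in> carrier W"
    have "?N +>\<^bsub>?F\<^esub> free_gen K (v \<oplus>\<^bsub>V\<^esub> v', w) =
        ?N +>\<^bsub>?F\<^esub> (free_gen K (v, w) \<oplus>\<^bsub>?F\<^esub> free_gen K (v', w))"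
    proof (rule eqI)
      show "free_gen K (v \<oplus>\<^bsub>V\<^esub> v', w) \<ominus>\<^bsub>?F\<^esub> (free_gen K (v, w) \<oplus>\<^bsub>?F\<^esub> free_gen K (v', w))
          \<in> tensor_relators K V W"
        unfolding tensor_relators_def Let_def using c by blast
    qed (intro d F.a_closed V.a_closed c)+
    then show "pure_tensor K V W (v \<oplus>\<^bsub>V\<^esub> v') w =
        pure_tensor K V W v w \<oplus>\<^bsub>tensor K V W\<^esub> pure_tensor K V W v' w"
      unfolding tensor_def pure_tensor_def using F.quotient_add[OF N d[OF c(1,3)] d[OF c(2,3)]] by metis
  next
    fix v w w' assume c: "v \<in> carrier V" "w \<in> carrier W" "w' \<in> carrier W"
    have "?N +>\<^bsub>?F\<^esub> free_gen K (v, w \<oplus>\<^bsub>W\<^esub> w') =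
        ?N +>\<^bsub>?F\<^esub> (free_gen K (v, w) \<oplus>\<^bsub>?F\<^esub> free_gen K (v, w'))"
    proof (rule eqI)
      show "free_gen K (v, w \<oplus>\<^bsub>W\<^esub> w') \<ominus>\<^bsub>?F\<^esub> (free_gen K (v, w) \<oplus>\<^bsub>?F\<^esub> free_gen K (v, w'))
          \<in> tensor_relators K V W"
        unfolding tensor_relators_def Let_def using c by blast
    qed (intro d F.a_closed W.a_closed c)+
    then show "pure_tensor K V W v (w \<oplus>\<^bsub>W\<^esub> w') =
        pure_tensor K V W v w \<oplus>\<^bsub>tensor K V W\<^esub> pure_tensor K V W v w'"
      unfolding tensor_def pure_tensor_def using F.quotient_add[OF N d[OF c(1,2)] d[OF c(1,3)]] by metis
  next
    fix k v w assume c: "k \<in> carrier K" "v \<in> carrier V" "w \<in> carrier W"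
    have "?N +>\<^bsub>?F\<^esub> free_gen K (k \<odot>\<^bsub>V\<^esub> v, w) = ?N +>\<^bsub>?F\<^esub> (k \<odot>\<^bsub>?F\<^esub> free_gen K (v, w))"
    proof (rule eqI)
      show "free_gen K (k \<odot>\<^bsub>V\<^esub> v, w) \<ominus>\<^bsub>?F\<^esub> k \<odot>\<^bsub>?F\<^esub> free_gen K (v, w) \<in> tensor_relators K V W"
        unfolding tensor_relators_def Let_def using c by blast
    qed (intro d F.smult_closed V.smult_closed c)+
    then show "pure_tensor K V W (k \<odot>\<^bsub>V\<^esub> v) w = k \<odot>\<^bsub>tensor K V W\<^esub> pure_tensor K V W v w"
      unfolding tensor_def pure_tensor_def using F.quotient_smult[OF N c(1) d[OF c(2,3)]] by metis
  next
    fix k v w assume c: "k \<in> carrier K" "v \<in> carrier V" "w \<in> carrier W"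
    have "?N +>\<^bsub>?F\<^esub> free_gen K (v, k \<odot>\<^bsub>W\<^esub> w) = ?N +>\<^bsub>?F\<^esub> (k \<odot>\<^bsub>?F\<^esub> free_gen K (v, w))"
    proof (rule eqI)
      show "free_gen K (v, k \<odot>\<^bsub>W\<^esub> w) \<ominus>\<^bsub>?F\<^esub> k \<odot>\<^bsub>?F\<^esub> free_gen K (v, w) \<in> tensor_relators K V W"
        unfolding tensor_relators_def Let_def using c by blast
    qed (intro d F.smult_closed W.smult_closed c)+
    then show "pure_tensor K V W v (k \<odot>\<^bsub>W\<^esub> w) = k \<odot>\<^bsub>tensor K V W\<^esub> pure_tensor K V W v w"
      unfolding tensor_def pure_tensor_def using F.quotient_smult[OF N c(1) d[OF c(2,3)]] by metis
  qed (fact pure_tensor_closed)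
qed

lemma linear_maps_agree:
  assumes h: "h \<in> linear_maps K (tensor K V W) U" and h': "h' \<in> linear_maps K (tensor K V W) U"
    and eq: "\<And>v w. v \<in> carrier V \<Longrightarrow> w \<in> carrier W \<Longrightarrow>
      h (pure_tensor K V W v w) = h' (pure_tensor K V W v w)"
  shows "h = h'"
proof -
  let ?F = "tensor_free K V W" and ?N = "tensor_null K V W" and ?T = "tensor K V W"
  interpret T: module K ?T by (rule tensor_module)
  note N = tensor_null_submodule
  have cos: "?N +>\<^bsub>?F\<^esub> x \<in> carrier ?T" if "x \<in> carrier ?F" for x
    unfolding tensor_def F.quotient_carrier using that by (rule imageI)
  have add: "?N +>\<^bsub>?F\<^esub> (x \<oplus>\<^bsub>?F\<^esub> y) = (?N +>\<^bsub>?F\<^esub> x) \<oplus>\<^bsub>?T\<^esub> (?N +>\<^bsub>?F\<^esub> y)"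
    if "x \<in> carrier ?F" "y \<in> carrier ?F" for x y
    unfolding tensor_def by (rule F.quotient_add[OF N that, symmetric])
  have smu: "?N +>\<^bsub>?F\<^esub> (c \<odot>\<^bsub>?F\<^esub> x) = c \<odot>\<^bsub>?T\<^esub> (?N +>\<^bsub>?F\<^esub> x)"
    if "c \<in> carrier K" "x \<in> carrier ?F" for c x
    unfolding tensor_def by (rule F.quotient_smult[OF N that, symmetric])
  have ha: "f ((?N +>\<^bsub>?F\<^esub> x) \<oplus>\<^bsub>?T\<^esub> (?N +>\<^bsub>?F\<^esub> y)) = f (?N +>\<^bsub>?F\<^esub> x) \<oplus>\<^bsub>U\<^esub> f (?N +>\<^bsub>?F\<^esub> y)"
    if "f \<in> linear_maps K ?T U" "x \<in> carrier ?F" "y \<in> carrier ?F" for f x y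
    using that cos unfolding linear_maps_def by blast
  have hs: "f (c \<odot>\<^bsub>?T\<^esub> (?N +>\<^bsub>?F\<^esub> x)) = c \<odot>\<^bsub>U\<^esub> f (?N +>\<^bsub>?F\<^esub> x)"
    if "f \<in> linear_maps K ?T U" "c \<in> carrier K" "x \<in> carrier ?F" for f c x
    using that cos unfolding linear_maps_def by blast
  define H where "H = {x \<in> carrier ?F. h (?N +>\<^bsub>?F\<^esub> x) = h' (?N +>\<^bsub>?F\<^esub> x)}"
  have Hsm: "c \<odot>\<^bsub>?F\<^esub> x \<in> H" if c: "c \<in> carrier K" and "x \<in> H" for c x
  proof -
    have x: "x \<in> carrier ?F" "h (?N +>\<^bsub>?F\<^esub> x) = h' (?N +>\<^bsub>?F\<^esub> x)" using \<open>x \<in> H\<close> by (auto simp: H_def)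
    show ?thesis unfolding H_def mem_Collect_eq smu[OF c x(1)] hs[OF h c x(1)] hs[OF h' c x(1)] x(2)
      using F.smult_closed[OF c x(1)] by blast
  qed
  have "submodule H K ?F"
  proof (rule F.submoduleI)
    show "H \<subseteq> carrier ?F" unfolding H_def by blast
    have "\<zero>\<^bsub>?F\<^esub> = \<zero>\<^bsub>K\<^esub> \<odot>\<^bsub>?F\<^esub> \<zero>\<^bsub>?F\<^esub>" using F.smult_l_null[OF F.zero_closed] by metis
    have hz: "f (?N +>\<^bsub>?F\<^esub> \<zero>\<^bsub>?F\<^esub>) = \<zero>\<^bsub>K\<^esub> \<odot>\<^bsub>U\<^esub> f (?N +>\<^bsub>?F\<^esub> z)"
      if "f \<in> linear_maps K ?T U" "z \<in> carrier ?F" for f z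
      using smu[OF V.R.zero_closed that(2)] hs[OF that(1) V.R.zero_closed that(2)]
        F.smult_l_null[OF that(2)] by metis
    show "\<zero>\<^bsub>?F\<^esub> \<in> H"
    proof -
      have g: "free_gen K (\<zero>\<^bsub>V\<^esub>, \<zero>\<^bsub>W\<^esub>) \<in> carrier ?F"
        by (rule free_gen_in_free[OF V.zero_closed W.zero_closed])
      have "h (?N +>\<^bsub>?F\<^esub> \<zero>\<^bsub>?F\<^esub>) = h' (?N +>\<^bsub>?F\<^esub> \<zero>\<^bsub>?F\<^esub>)"
        unfolding hz[OF h g] hz[OF h' g]
        using eq[OF V.zero_closed W.zero_closed] by (simp only: pure_tensor_def)
      then show ?thesis unfolding H_def using F.zero_closed by blast
    qed
    fix x assume xH: "x \<in> H"
    then have xF: "x \<in> carrier ?F" unfolding H_def by blast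
    have "\<ominus>\<^bsub>?F\<^esub> x = (\<ominus>\<^bsub>K\<^esub> \<one>\<^bsub>K\<^esub>) \<odot>\<^bsub>?F\<^esub> x"
      using F.smult_l_minus[OF V.R.one_closed xF] F.smult_one[OF xF] by metis
    then show "\<ominus>\<^bsub>?F\<^esub> x \<in> H" using Hsm[OF V.R.a_inv_closed[OF V.R.one_closed] xH] by metis
    fix y assume yH: "y \<in> H"
    then have yF: "y \<in> carrier ?F" unfolding H_def by blast
    have e: "h (?N +>\<^bsub>?F\<^esub> x) = h' (?N +>\<^bsub>?F\<^esub> x)" "h (?N +>\<^bsub>?F\<^esub> y) = h' (?N +>\<^bsub>?F\<^esub> y)"
      using xH yH unfolding H_def by blast+
    show "x \<oplus>\<^bsub>?F\<^esub> y \<in> H"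
      unfolding H_def mem_Collect_eq add[OF xF yF] ha[OF h xF yF] ha[OF h' xF yF] e
      using F.a_closed[OF xF yF] by blast
  qed (fact Hsm)
  moreover have "free_gen K s \<in> H" if s: "s \<in> carrier V \<times> carrier W" for s
  proof -
    obtain v w where vw: "s = (v, w)" "v \<in> carrier V" "w \<in> carrier W" using s by blast
    show ?thesis unfolding H_def vw(1) mem_Collect_eq
      using free_gen_in_free[OF vw(2,3)] eq[OF vw(2,3)] unfolding pure_tensor_def by blast
  qed
  ultimately have "carrier ?F \<subseteq> H"
    using V.R.free_module_span[of H "carrier V \<times> carrier W"] by blast
  then have "h X = h' X" if "X \<in> carrier ?T" for X
    using that unfolding tensor_def F.quotient_carrier H_def by blast
  moreover have "h \<in> extensional (carrier ?T)" "h' \<in> extensional (carrier ?T)"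
    using h h' unfolding linear_maps_def PiE_def by blast+
  ultimately show ?thesis by (intro extensionalityI)
qed

context
  fixes U :: "('k, 'u, 'r) module_scheme" and b :: "'v \<Rightarrow> 'w \<Rightarrow> 'u"
  assumes U: "module K U" and b: "bilinear_map K V W U b"
begin

interpretation U: module K U by (rule U)

private lemma b_closed: "v \<in> carrier V \<Longrightarrow> w \<in> carrier W \<Longrightarrow> b v w \<in> carrier U"
  using b unfolding bilinear_map_def by blast

private definition free_lift :: "('v \<times> 'w \<Rightarrow> 'k) \<Rightarrow> 'u"
  where "free_lift f = (\<Oplus>\<^bsub>U\<^esub>p\<in>{p. f p \<noteq> \<zero>\<^bsub>K\<^esub>}. f p \<odot>\<^bsub>U\<^esub> (case p of (v, w) \<Rightarrow> b v w))"

private lemma case_b_closed: "p \<in> carrier V \<times> carrier W \<Longrightarrow> (case p of (v, w) \<Rightarrow> b v w) \<in> carrier U"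
  using b_closed by auto

private lemma free_lift_superset:
  assumes f: "range f \<subseteq> carrier K" and T: "finite T" "T \<subseteq> carrier V \<times> carrier W"
    and supp: "{p. f p \<noteq> \<zero>\<^bsub>K\<^esub>} \<subseteq> T"
  shows "free_lift f = (\<Oplus>\<^bsub>U\<^esub>p\<in>T. f p \<odot>\<^bsub>U\<^esub> (case p of (v, w) \<Rightarrow> b v w))"
  unfolding free_lift_def
proof (rule U.add.finprod_mono_neutral_cong_left)
  have c: "f p \<odot>\<^bsub>U\<^esub> (case p of (v, w) \<Rightarrow> b v w) \<in> carrier U" if "p \<in> T" for p
    using that f T(2) case_b_closed[of p] by (intro U.smult_closed) blast+
  then show "(\<lambda>p. f p \<odot>\<^bsub>U\<^esub> (case p of (v, w) \<Rightarrow> b v w)) \<in> T \<rightarrow> carrier U" by blast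
  show "f p \<odot>\<^bsub>U\<^esub> (case p of (v, w) \<Rightarrow> b v w) = \<zero>\<^bsub>U\<^esub>" if "p \<in> T - {p. f p \<noteq> \<zero>\<^bsub>K\<^esub>}" for p
    using that T(2) case_b_closed[of p] U.smult_l_null by fastforce
qed (use T supp in auto)

private lemma free_lift_closed: "f \<in> carrier (tensor_free K V W) \<Longrightarrow> free_lift f \<in> carrier U"
  unfolding free_lift_def
  by (rule U.finsum_closed, intro Pi_I U.smult_closed case_b_closed) auto

private lemma free_lift_add:
  assumes f: "f \<in> carrier (tensor_free K V W)" and g: "g \<in> carrier (tensor_free K V W)"
  shows "free_lift (f \<oplus>\<^bsub>tensor_free K V W\<^esub> g) = free_lift f \<oplus>\<^bsub>U\<^esub> free_lift g"
proof -
  define T where "T = {p. f p \<noteq> \<zero>\<^bsub>K\<^esub>} \<union> {p. g p \<noteq> \<zero>\<^bsub>K\<^esub>}"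
  have T: "finite T" "T \<subseteq> carrier V \<times> carrier W"
    unfolding T_def using f g by auto
  have cf: "f p \<in> carrier K" and cg: "g p \<in> carrier K" for p using f g by auto
  have fg: "free_lift (\<lambda>p. f p \<oplus>\<^bsub>K\<^esub> g p) =
      (\<Oplus>\<^bsub>U\<^esub>p\<in>T. (f p \<oplus>\<^bsub>K\<^esub> g p) \<odot>\<^bsub>U\<^esub> (case p of (v, w) \<Rightarrow> b v w))"
    by (rule free_lift_superset[OF _ T]) (use cf cg in \<open>auto simp: T_def\<close>)
  have f1: "free_lift f = (\<Oplus>\<^bsub>U\<^esub>p\<in>T. f p \<odot>\<^bsub>U\<^esub> (case p of (v, w) \<Rightarrow> b v w))"
    by (rule free_lift_superset[OF _ T]) (use cf in \<open>auto simp: T_def\<close>)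
  have g1: "free_lift g = (\<Oplus>\<^bsub>U\<^esub>p\<in>T. g p \<odot>\<^bsub>U\<^esub> (case p of (v, w) \<Rightarrow> b v w))"
    by (rule free_lift_superset[OF _ T]) (use cg in \<open>auto simp: T_def\<close>)
  have cb: "(case p of (v, w) \<Rightarrow> b v w) \<in> carrier U" if "p \<in> T" for p
    using that T(2) case_b_closed by blast
  have "(\<Oplus>\<^bsub>U\<^esub>p\<in>T. (f p \<oplus>\<^bsub>K\<^esub> g p) \<odot>\<^bsub>U\<^esub> (case p of (v, w) \<Rightarrow> b v w)) =
     (\<Oplus>\<^bsub>U\<^esub>p\<in>T. f p \<odot>\<^bsub>U\<^esub> (case p of (v, w) \<Rightarrow> b v w) \<oplus>\<^bsub>U\<^esub> g p \<odot>\<^bsub>U\<^esub> (case p of (v, w) \<Rightarrow> b v w))"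
    by (rule U.finsum_cong')
      (use cb cf cg U.smult_l_distr in \<open>auto intro!: U.smult_closed U.a_closed simp del: split_paired_All\<close>)
  also have "\<dots> = free_lift f \<oplus>\<^bsub>U\<^esub> free_lift g"
    unfolding f1 g1 by (rule U.finsum_addf) (use cb cf cg in \<open>auto intro!: U.smult_closed\<close>)
  finally show ?thesis using fg by simp
qed

private lemma free_lift_smult:
  assumes c: "c \<in> carrier K" and f: "f \<in> carrier (tensor_free K V W)"
  shows "free_lift (c \<odot>\<^bsub>tensor_free K V W\<^esub> f) = c \<odot>\<^bsub>U\<^esub> free_lift f"
proof -
  define T where "T = {p. f p \<noteq> \<zero>\<^bsub>K\<^esub>}"
  have T: "finite T" "T \<subseteq> carrier V \<times> carrier W"
    unfolding T_def using f by auto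
  have cf: "f p \<in> carrier K" for p using f by auto
  have cb: "(case p of (v, w) \<Rightarrow> b v w) \<in> carrier U" if "p \<in> T" for p
    using that T(2) case_b_closed by blast
  have "free_lift (\<lambda>p. c \<otimes>\<^bsub>K\<^esub> f p) =
      (\<Oplus>\<^bsub>U\<^esub>p\<in>T. (c \<otimes>\<^bsub>K\<^esub> f p) \<odot>\<^bsub>U\<^esub> (case p of (v, w) \<Rightarrow> b v w))"
    by (rule free_lift_superset[OF _ T]) (use c cf in \<open>auto simp: T_def\<close>)
  also have "\<dots> = (\<Oplus>\<^bsub>U\<^esub>p\<in>T. c \<odot>\<^bsub>U\<^esub> (f p \<odot>\<^bsub>U\<^esub> (case p of (v, w) \<Rightarrow> b v w)))"
    by (rule U.finsum_cong') (use cb c cf U.smult_assoc1 in \<open>auto intro!: U.smult_closed\<close>)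
  also have "\<dots> = c \<odot>\<^bsub>U\<^esub> free_lift f"
    unfolding free_lift_def T_def[symmetric]
    by (rule U.finsum_smult_ldistr[symmetric]) (use T c cb cf in \<open>auto intro!: U.smult_closed\<close>)
  finally show ?thesis by simp
qed

private lemma free_lift_minus:
  assumes f: "f \<in> carrier (tensor_free K V W)"
  shows "free_lift (\<ominus>\<^bsub>tensor_free K V W\<^esub> f) = \<ominus>\<^bsub>U\<^esub> free_lift f"
proof -
  have "\<ominus>\<^bsub>tensor_free K V W\<^esub> f = (\<ominus>\<^bsub>K\<^esub> \<one>\<^bsub>K\<^esub>) \<odot>\<^bsub>tensor_free K V W\<^esub> f"
    using F.smult_l_minus[OF V.R.one_closed f] F.smult_one[OF f] by metis
  moreover have "(\<ominus>\<^bsub>K\<^esub> \<one>\<^bsub>K\<^esub>) \<odot>\<^bsub>U\<^esub> free_lift f = \<ominus>\<^bsub>U\<^esub> free_lift f"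
    using U.smult_l_minus[OF V.R.one_closed free_lift_closed[OF f]] U.smult_one[OF free_lift_closed[OF f]]
    by metis
  ultimately show ?thesis
    using free_lift_smult[OF V.R.a_inv_closed[OF V.R.one_closed] f] by metis
qed

private lemma free_lift_diff:
  assumes f: "f \<in> carrier (tensor_free K V W)" and g: "g \<in> carrier (tensor_free K V W)"
  shows "free_lift (f \<ominus>\<^bsub>tensor_free K V W\<^esub> g) = free_lift f \<ominus>\<^bsub>U\<^esub> free_lift g"
  unfolding a_minus_def
  using free_lift_add[OF f F.a_inv_closed[OF g]] free_lift_minus[OF g] by metis

private lemma free_lift_gen:
  assumes v: "v \<in> carrier V" and w: "w \<in> carrier W"
  shows "free_lift (free_gen K (v, w)) = b v w"
proof -
  have "free_lift (free_gen K (v, w)) =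
      (\<Oplus>\<^bsub>U\<^esub>p\<in>{(v, w)}. free_gen K (v, w) p \<odot>\<^bsub>U\<^esub> (case p of (v, w) \<Rightarrow> b v w))"
    by (rule free_lift_superset) (use v w in \<open>auto simp: free_gen_def split: if_splits\<close>)
  also have "\<dots> = free_gen K (v, w) (v, w) \<odot>\<^bsub>U\<^esub> b v w"
    using b_closed[OF v w] by (subst U.finsum_insert) (auto simp: free_gen_def)
  also have "\<dots> = b v w"
    using b_closed[OF v w] by (simp add: free_gen_def)
  finally show ?thesis .
qed

private lemma free_lift_null:
  assumes "f \<in> tensor_null K V W"
  shows "free_lift f = \<zero>\<^bsub>U\<^esub>"
proof -
  let ?F = "tensor_free K V W"
  define H where "H = {f \<in> carrier ?F. free_lift f = \<zero>\<^bsub>U\<^esub>}"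
  have Hc: "f \<in> carrier ?F" and H0: "free_lift f = \<zero>\<^bsub>U\<^esub>" if "f \<in> H" for f
    using that unfolding H_def by blast+
  have HI: "f \<in> H" if "f \<in> carrier ?F" "free_lift f = \<zero>\<^bsub>U\<^esub>" for f
    using that unfolding H_def by blast
  have "submodule H K ?F"
  proof (rule F.submoduleI)
    show "H \<subseteq> carrier ?F" using Hc by blast
    have "free_lift \<zero>\<^bsub>?F\<^esub> = \<zero>\<^bsub>U\<^esub>" by (simp add: free_lift_def)
    then show "\<zero>\<^bsub>?F\<^esub> \<in> H" using HI[OF F.zero_closed] by blast
    fix f assume f: "f \<in> H"
    have "free_lift (\<ominus>\<^bsub>?F\<^esub> f) = \<zero>\<^bsub>U\<^esub>"
      unfolding free_lift_minus[OF Hc[OF f]] H0[OF f] by (rule U.minus_equality) simp_all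
    then show "\<ominus>\<^bsub>?F\<^esub> f \<in> H" by (rule HI[OF F.a_inv_closed[OF Hc[OF f]]])
    fix g assume g: "g \<in> H"
    have "free_lift (f \<oplus>\<^bsub>?F\<^esub> g) = \<zero>\<^bsub>U\<^esub>"
      unfolding free_lift_add[OF Hc[OF f] Hc[OF g]] H0[OF f] H0[OF g] by (rule U.l_zero[OF U.zero_closed])
    then show "f \<oplus>\<^bsub>?F\<^esub> g \<in> H" by (rule HI[OF F.a_closed[OF Hc[OF f] Hc[OF g]]])
  next
    fix c f assume c: "c \<in> carrier K" and f: "f \<in> H"
    have "free_lift (c \<odot>\<^bsub>?F\<^esub> f) = \<zero>\<^bsub>U\<^esub>"
      unfolding free_lift_smult[OF c Hc[OF f]] H0[OF f] by (rule U.smult_r_null[OF c])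
    then show "c \<odot>\<^bsub>?F\<^esub> f \<in> H" by (rule HI[OF F.smult_closed[OF c Hc[OF f]]])
  qed
  moreover have "tensor_relators K V W \<subseteq> H"
  proof
    fix f assume fr: "f \<in> tensor_relators K V W"
    note d = free_gen_in_free
    have z: "x \<ominus>\<^bsub>U\<^esub> y = \<zero>\<^bsub>U\<^esub>" if "x \<in> carrier U" "x = y" for x y
      using that U.r_neg by (simp add: a_minus_def)
    have "free_lift f = \<zero>\<^bsub>U\<^esub>"
      using fr b unfolding tensor_relators_def Let_def bilinear_map_def
      by (elim UnE CollectE exE conjE; hypsubst)
        (subst free_lift_diff free_lift_add free_lift_smult free_lift_gen
          | intro z d F.a_closed F.smult_closed V.a_closed W.a_closed V.smult_closed W.smult_closed b_closed
          | assumption | blast)+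
    then show "f \<in> H" using fr tensor_relators_closed by (intro HI) blast+
  qed
  ultimately have "tensor_null K V W \<subseteq> H"
    unfolding tensor_null_def submodule_span_def by blast
  then show ?thesis using assms H0 by blast
qed

lemma tensor_universal:
  "\<exists>!h. h \<in> linear_maps K (tensor K V W) U \<and>
     (\<forall>v\<in>carrier V. \<forall>w\<in>carrier W. h (pure_tensor K V W v w) = b v w)"
proof -
  let ?F = "tensor_free K V W" and ?N = "tensor_null K V W" and ?T = "tensor K V W"
  interpret T: module K ?T by (rule tensor_module)
  note N = tensor_null_submodule
  interpret N: abelian_subgroup ?N ?F by (rule F.quotient_abelian_subgroup[OF N])
  define h where "h = (\<lambda>X\<in>carrier ?T. free_lift (SOME x. x \<in> X))"
  have cos: "?N +>\<^bsub>?F\<^esub> x \<in> carrier ?T" if "x \<in> carrier ?F" for x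
    unfolding tensor_def F.quotient_carrier using that by (rule imageI)
  have add: "?N +>\<^bsub>?F\<^esub> (x \<oplus>\<^bsub>?F\<^esub> y) = (?N +>\<^bsub>?F\<^esub> x) \<oplus>\<^bsub>?T\<^esub> (?N +>\<^bsub>?F\<^esub> y)"
    if "x \<in> carrier ?F" "y \<in> carrier ?F" for x y
    unfolding tensor_def by (rule F.quotient_add[OF N that, symmetric])
  have smu: "?N +>\<^bsub>?F\<^esub> (c \<odot>\<^bsub>?F\<^esub> x) = c \<odot>\<^bsub>?T\<^esub> (?N +>\<^bsub>?F\<^esub> x)"
    if "c \<in> carrier K" "x \<in> carrier ?F" for c x
    unfolding tensor_def by (rule F.quotient_smult[OF N that, symmetric])
  have rep: "\<exists>x\<in>carrier ?F. X = ?N +>\<^bsub>?F\<^esub> x" if "X \<in> carrier ?T" for X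
    using that unfolding tensor_def F.quotient_carrier by blast
  have h: "h (?N +>\<^bsub>?F\<^esub> x) = free_lift x" if x: "x \<in> carrier ?F" for x
  proof -
    define y where "y = (SOME y. y \<in> ?N +>\<^bsub>?F\<^esub> x)"
    have "x \<in> ?N +>\<^bsub>?F\<^esub> x" using x by (rule N.a_rcos_self)
    then have y: "y \<in> ?N +>\<^bsub>?F\<^esub> x" unfolding y_def by (rule someI[where P = "\<lambda>y. y \<in> _"])
    then have yF: "y \<in> carrier ?F" using x N.a_elemrcos_carrier by blast
    have "?N +>\<^bsub>?F\<^esub> y = ?N +>\<^bsub>?F\<^esub> x"
      using F.a_repr_independence'[folded a_r_coset_def, OF y x N.a_subgroup] by metis
    then have "y \<ominus>\<^bsub>?F\<^esub> x \<in> ?N" using F.quotient_eq_iff[OF N yF x] by blast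
    then have "free_lift y \<ominus>\<^bsub>U\<^esub> free_lift x = \<zero>\<^bsub>U\<^esub>"
      using free_lift_null free_lift_diff[OF yF x] by metis
    then have "free_lift y = free_lift x"
      using U.minus_equality[of "free_lift y" "\<ominus>\<^bsub>U\<^esub> free_lift x"]
        free_lift_closed[OF x] free_lift_closed[OF yF] by (simp add: a_minus_def)
    then show ?thesis unfolding h_def restrict_def if_P[OF cos[OF x]] y_def .
  qed
  show ?thesis
  proof (rule ex_ex1I)
    show "\<exists>h. h \<in> linear_maps K ?T U \<and>
       (\<forall>v\<in>carrier V. \<forall>w\<in>carrier W. h (pure_tensor K V W v w) = b v w)"
    proof (intro exI[of _ h] conjI ballI)
      show "h (pure_tensor K V W v w) = b v w" if "v \<in> carrier V" "w \<in> carrier W" for v w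
        unfolding pure_tensor_def h[OF free_gen_in_free[OF that]] by (rule free_lift_gen[OF that])
      have "h X \<in> carrier U" if "X \<in> carrier ?T" for X
        using rep[OF that] h free_lift_closed by metis
      then have "h \<in> carrier ?T \<rightarrow>\<^sub>E carrier U" unfolding h_def by auto
      moreover have "h (X \<oplus>\<^bsub>?T\<^esub> Y) = h X \<oplus>\<^bsub>U\<^esub> h Y" if X: "X \<in> carrier ?T" and Y: "Y \<in> carrier ?T" for X Y
      proof -
        obtain x y where x: "x \<in> carrier ?F" "X = ?N +>\<^bsub>?F\<^esub> x" and y: "y \<in> carrier ?F" "Y = ?N +>\<^bsub>?F\<^esub> y"
          using rep[OF X] rep[OF Y] by blast
        show ?thesis unfolding x(2) y(2) add[OF x(1) y(1), symmetric]
            h[OF x(1)] h[OF y(1)] h[OF F.a_closed[OF x(1) y(1)]]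
          by (rule free_lift_add[OF x(1) y(1)])
      qed
      moreover have "h (c \<odot>\<^bsub>?T\<^esub> X) = c \<odot>\<^bsub>U\<^esub> h X" if c: "c \<in> carrier K" and X: "X \<in> carrier ?T" for c X
      proof -
        obtain x where x: "x \<in> carrier ?F" "X = ?N +>\<^bsub>?F\<^esub> x" using rep[OF X] by blast
        show ?thesis unfolding x(2) smu[OF c x(1), symmetric] h[OF x(1)] h[OF F.smult_closed[OF c x(1)]]
          by (rule free_lift_smult[OF c x(1)])
      qed
      ultimately show "h \<in> linear_maps K ?T U" unfolding linear_maps_def by blast
    qed
  qed (metis linear_maps_agree)
qed

end

end

declare free_module_simps [simp del]

subsection \<open>Maps between tensor products\<close>

text \<open>The linear map out of the tensor product induced by a bilinear map \<^term>\<open>b\<close>; existence and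
  uniqueness are \<open>tensor_universal\<close>.\<close>

definition tensor_lift ::
    "('k, 'm) ring_scheme \<Rightarrow> ('k, 'v, 'p) module_scheme \<Rightarrow> ('k, 'w, 'q) module_scheme
      \<Rightarrow> ('k, 'u, 'r) module_scheme \<Rightarrow> ('v \<Rightarrow> 'w \<Rightarrow> 'u) \<Rightarrow> ('v \<times> 'w \<Rightarrow> 'k) set \<Rightarrow> 'u"
  where "tensor_lift K V W U b =
    (THE h. h \<in> linear_maps K (tensor K V W) U \<and>
       (\<forall>v\<in>carrier V. \<forall>w\<in>carrier W. h (pure_tensor K V W v w) = b v w))"

lemma tensor_lift_props:
  assumes "module K V" "module K W" "module K U" "bilinear_map K V W U b"
  shows tensor_lift_linear: "tensor_lift K V W U b \<in> linear_maps K (tensor K V W) U"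
    and tensor_lift_pure: "\<lbrakk>v \<in> carrier V; w \<in> carrier W\<rbrakk> \<Longrightarrow>
      tensor_lift K V W U b (pure_tensor K V W v w) = b v w"
  using theI'[OF tensor_universal[OF assms]] unfolding tensor_lift_def[symmetric] by blast+

definition tensor_map ::
    "('k, 'm) ring_scheme \<Rightarrow> ('k, 'v, 'p) module_scheme \<Rightarrow> ('k, 'w, 'q) module_scheme
      \<Rightarrow> ('k, 'v', 'p') module_scheme \<Rightarrow> ('k, 'w', 'q') module_scheme
      \<Rightarrow> ('v \<Rightarrow> 'v') \<Rightarrow> ('w \<Rightarrow> 'w') \<Rightarrow> ('v \<times> 'w \<Rightarrow> 'k) set \<Rightarrow> ('v' \<times> 'w' \<Rightarrow> 'k) set"
  where "tensor_map K V W V' W' f g =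
    tensor_lift K V W (tensor K V' W') (\<lambda>v w. pure_tensor K V' W' (f v) (g w))"

text \<open>The two mutually inverse associativity isomorphisms, determined by
  \<open>(u \<otimes> v) \<otimes> w \<mapsto> u \<otimes> (v \<otimes> w)\<close> and \<open>u \<otimes> (v \<otimes> w) \<mapsto> (u \<otimes> v) \<otimes> w\<close>.\<close>

definition tensor_assoc ::
    "('k, 'm) ring_scheme \<Rightarrow> ('k, 'u, 'r) module_scheme \<Rightarrow> ('k, 'v, 'p) module_scheme
      \<Rightarrow> ('k, 'w, 'q) module_scheme
      \<Rightarrow> (('u \<times> 'v \<Rightarrow> 'k) set \<times> 'w \<Rightarrow> 'k) set \<Rightarrow> ('u \<times> ('v \<times> 'w \<Rightarrow> 'k) set \<Rightarrow> 'k) set"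
  where "tensor_assoc K U V W =
    (let T = tensor K U (tensor K V W) in
      tensor_lift K (tensor K U V) W T
        (\<lambda>x w. tensor_lift K U V T
          (\<lambda>u v. pure_tensor K U (tensor K V W) u (pure_tensor K V W v w)) x))"

definition tensor_assoc_inv ::
    "('k, 'm) ring_scheme \<Rightarrow> ('k, 'u, 'r) module_scheme \<Rightarrow> ('k, 'v, 'p) module_scheme
      \<Rightarrow> ('k, 'w, 'q) module_scheme
      \<Rightarrow> ('u \<times> ('v \<times> 'w \<Rightarrow> 'k) set \<Rightarrow> 'k) set \<Rightarrow> (('u \<times> 'v \<Rightarrow> 'k) set \<times> 'w \<Rightarrow> 'k) set"
  where "tensor_assoc_inv K U V W =
    (let T = tensor K (tensor K U V) W in
      tensor_lift K U (tensor K V W) T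
        (\<lambda>u y. tensor_lift K V W T
          (\<lambda>v w. pure_tensor K (tensor K U V) W (pure_tensor K U V u v) w) y))"

section \<open>Nearly Frobenius coproducts\<close>

definition mult_map ::
    "('k, 'm) ring_scheme \<Rightarrow> ('k, 'a, 'p) module_scheme \<Rightarrow> ('a \<times> 'a \<Rightarrow> 'k) set \<Rightarrow> 'a"
  where "mult_map K A = tensor_lift K A A A (\<lambda>x y. x \<otimes>\<^bsub>A\<^esub> y)"

text \<open>The equations are those usually written \<open>(D \<otimes> 1) \<circ> D = (1 \<otimes> D) \<circ> D\<close>,
  \<open>D \<circ> m = (1 \<otimes> m) \<circ> (D \<otimes> 1)\<close> and \<open>D \<circ> m = (m \<otimes> 1) \<circ> (1 \<otimes> D)\<close>, with the identification
  of the two triple tensor products made explicit.\<close>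

definition nearly_frobenius_coproduct ::
    "('k, 'm) ring_scheme \<Rightarrow> ('k, 'a, 'p) module_scheme \<Rightarrow> ('a \<Rightarrow> ('a \<times> 'a \<Rightarrow> 'k) set) \<Rightarrow> bool"
  where "nearly_frobenius_coproduct K A D \<longleftrightarrow>
    (let AA = tensor K A A; m = mult_map K A in
      D \<in> linear_maps K A AA \<and>
      (\<forall>a\<in>carrier A.
        tensor_assoc K A A A (tensor_map K A A AA A D id (D a)) = tensor_map K A A A AA id D (D a)) \<and>
      (\<forall>x\<in>carrier AA.
        D (m x) = tensor_map K A AA A A id m (tensor_assoc K A A A (tensor_map K A A AA A D id x))) \<and>
      (\<forall>x\<in>carrier AA.
        D (m x) = tensor_map K AA A A A m id (tensor_assoc_inv K A A A (tensor_map K A A A AA id D x))))"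

definition coproduct_space ::
    "('k, 'm) ring_scheme \<Rightarrow> ('k, 'a, 'p) module_scheme \<Rightarrow> ('k, 'a \<Rightarrow> ('a \<times> 'a \<Rightarrow> 'k) set) module"
  where "coproduct_space K A =
    (hom_module K A (tensor K A A))\<lparr>carrier := {D. nearly_frobenius_coproduct K A D}\<rparr>"

end

theory Submission
  imports Defs
begin

text \<open>
  Linearity of \<open>D\<close> and the two bimodule equations are preserved by sums and scalar multiples, but
  coassociativity is quadratic in \<open>D\<close>, so the content of the theorem is that it is redundant.
  Write \<open>u = D 1\<close>. Being a bimodule map means
  \<open>D (x y) = D x \<cdot> y\<close> and \<open>D (x y) = x \<cdot> D y\<close>, where \<open>A\<close> acts on the outer sides of
  \<open>A \<otimes> A\<close>; since \<open>A\<close> has a unit, \<open>D a = u \<cdot> a = a \<cdot> u\<close>. If \<open>u = \<Sum> p\<^sub>i \<otimes> q\<^sub>i\<close>, then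

  \<open>(D \<otimes> 1) (z \<otimes> w) = (u \<cdot> z) \<otimes> w = \<Sum> p\<^sub>i \<otimes> q\<^sub>i z \<otimes> w = \<Sum> p\<^sub>i \<otimes> (q\<^sub>i \<cdot> (z \<otimes> w))\<close>,

  and therefore, replacing \<open>z \<otimes> w\<close> by the tensor \<open>D a\<close>,

  \<open>(D \<otimes> 1) (D a) = \<Sum> p\<^sub>i \<otimes> (q\<^sub>i \<cdot> D a) = \<Sum> p\<^sub>i \<otimes> D (q\<^sub>i a) = (1 \<otimes> D) (u \<cdot> a) = (1 \<otimes> D) (D a)\<close>.

  Hence the nearly Frobenius coproducts are exactly the bimodule maps
  (\<open>nearly_frobenius_iff_bimodule_map\<close>), and these form a subspace of the space of linear maps.
  The sums over representatives of \<open>u\<close> are replaced throughout by linear maps out of a tensor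
  product, which are compared on pure tensors (\<open>tensor_eqI\<close>).
\<close>

section \<open>Linear functions\<close>

text \<open>Linearity on the carrier alone. In contrast to \<^const>\<open>linear_maps\<close> it constrains no value
  off the carrier, so \<^const>\<open>id\<close> and composites written with \<open>\<lambda>\<close> qualify.\<close>

definition linear_fun ::
    "('k, 'm) ring_scheme \<Rightarrow> ('k, 'v, 'p) module_scheme \<Rightarrow> ('k, 'w, 'q) module_scheme \<Rightarrow> ('v \<Rightarrow> 'w) \<Rightarrow> bool"
  where "linear_fun K V W f \<longleftrightarrow>
    (\<forall>x\<in>carrier V. f x \<in> carrier W) \<and>
    (\<forall>x\<in>carrier V. \<forall>y\<in>carrier V. f (x \<oplus>\<^bsub>V\<^esub> y) = f x \<oplus>\<^bsub>W\<^esub> f y) \<and>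
    (\<forall>c\<in>carrier K. \<forall>x\<in>carrier V. f (c \<odot>\<^bsub>V\<^esub> x) = c \<odot>\<^bsub>W\<^esub> f x)"

lemma linear_funI:
  assumes "\<And>x. x \<in> carrier V \<Longrightarrow> f x \<in> carrier W"
    and "\<And>x y. x \<in> carrier V \<Longrightarrow> y \<in> carrier V \<Longrightarrow> f (x \<oplus>\<^bsub>V\<^esub> y) = f x \<oplus>\<^bsub>W\<^esub> f y"
    and "\<And>c x. c \<in> carrier K \<Longrightarrow> x \<in> carrier V \<Longrightarrow> f (c \<odot>\<^bsub>V\<^esub> x) = c \<odot>\<^bsub>W\<^esub> f x"
  shows "linear_fun K V W f"
  using assms unfolding linear_fun_def by blast

lemma linear_funD:
  assumes "linear_fun K V W f"
  shows linear_fun_closed: "x \<in> carrier V \<Longrightarrow> f x \<in> carrier W"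
    and linear_fun_add: "x \<in> carrier V \<Longrightarrow> y \<in> carrier V \<Longrightarrow> f (x \<oplus>\<^bsub>V\<^esub> y) = f x \<oplus>\<^bsub>W\<^esub> f y"
    and linear_fun_smult: "c \<in> carrier K \<Longrightarrow> x \<in> carrier V \<Longrightarrow> f (c \<odot>\<^bsub>V\<^esub> x) = c \<odot>\<^bsub>W\<^esub> f x"
  using assms unfolding linear_fun_def by blast+

lemma linear_maps_iff:
  "f \<in> linear_maps K V W \<longleftrightarrow> linear_fun K V W f \<and> f \<in> extensional (carrier V)"
  unfolding linear_maps_def linear_fun_def PiE_def by blast

lemma linear_maps_linear_fun: "f \<in> linear_maps K V W \<Longrightarrow> linear_fun K V W f"
  by (simp add: linear_maps_iff)

lemma linear_fun_id: "linear_fun K V V id"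
  by (simp add: linear_fun_def)

lemma linear_fun_comp:
  assumes "linear_fun K V W f" and "linear_fun K U V g"
  shows "linear_fun K U W (\<lambda>x. f (g x))"
  using assms by (simp add: linear_fun_def)

lemma linear_fun_restrict:
  assumes "module K V" and f: "linear_fun K V W f"
  shows "restrict f (carrier V) \<in> linear_maps K V W"
proof -
  interpret V: module K V by fact
  show ?thesis unfolding linear_maps_iff linear_fun_def
    using f by (auto dest: linear_funD)
qed

lemma linear_fun_zero:
  assumes "module K V" and "module K W" and f: "linear_fun K V W f"
  shows "f \<zero>\<^bsub>V\<^esub> = \<zero>\<^bsub>W\<^esub>"
proof -
  interpret V: module K V by fact
  interpret W: module K W by fact
  have "f \<zero>\<^bsub>V\<^esub> = f (\<zero>\<^bsub>K\<^esub> \<odot>\<^bsub>V\<^esub> \<zero>\<^bsub>V\<^esub>)" by simp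
  also have "\<dots> = \<zero>\<^bsub>K\<^esub> \<odot>\<^bsub>W\<^esub> f \<zero>\<^bsub>V\<^esub>" using f by (rule linear_fun_smult) simp_all
  also have "\<dots> = \<zero>\<^bsub>W\<^esub>" using linear_fun_closed[OF f V.zero_closed] by simp
  finally show ?thesis .
qed

lemma linear_fun_zero_map:
  assumes "module K W"
  shows "linear_fun K V W (\<lambda>x. \<zero>\<^bsub>W\<^esub>)"
proof -
  interpret W: module K W by fact
  show ?thesis by (simp add: linear_fun_def)
qed

lemma linear_fun_sum:
  assumes "module K W" and f: "linear_fun K V W f" and g: "linear_fun K V W g"
  shows "linear_fun K V W (\<lambda>x. f x \<oplus>\<^bsub>W\<^esub> g x)"
proof -
  interpret W: module K W by fact
  show ?thesis
    by (rule linear_funI)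
      (simp_all add: linear_funD[OF f] linear_funD[OF g] W.smult_r_distr W.M.a_ac)
qed

lemma linear_fun_scaled:
  assumes "module K W" and f: "linear_fun K V W f" and c: "c \<in> carrier K"
  shows "linear_fun K V W (\<lambda>x. c \<odot>\<^bsub>W\<^esub> f x)"
proof -
  interpret W: module K W by fact
  show ?thesis
  proof (rule linear_funI)
    fix d x assume d: "d \<in> carrier K" and x: "x \<in> carrier V"
    have fx: "f x \<in> carrier W" using f x by (rule linear_fun_closed)
    have "c \<odot>\<^bsub>W\<^esub> f (d \<odot>\<^bsub>V\<^esub> x) = (c \<otimes>\<^bsub>K\<^esub> d) \<odot>\<^bsub>W\<^esub> f x"
      using c d fx by (simp add: linear_fun_smult[OF f d x] W.smult_assoc1)
    also have "\<dots> = d \<odot>\<^bsub>W\<^esub> (c \<odot>\<^bsub>W\<^esub> f x)"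
      using c d fx by (simp add: W.R.m_comm[OF c d] W.smult_assoc1)
    finally show "c \<odot>\<^bsub>W\<^esub> f (d \<odot>\<^bsub>V\<^esub> x) = d \<odot>\<^bsub>W\<^esub> (c \<odot>\<^bsub>W\<^esub> f x)" .
  qed (simp_all add: linear_funD[OF f] c W.smult_r_distr)
qed

lemma hom_module_simps:
  "f \<in> carrier (hom_module K V W) \<longleftrightarrow> f \<in> linear_maps K V W"
  "\<zero>\<^bsub>hom_module K V W\<^esub> = (\<lambda>x\<in>carrier V. \<zero>\<^bsub>W\<^esub>)"
  "f \<oplus>\<^bsub>hom_module K V W\<^esub> g = (\<lambda>x\<in>carrier V. f x \<oplus>\<^bsub>W\<^esub> g x)"
  "c \<odot>\<^bsub>hom_module K V W\<^esub> f = (\<lambda>x\<in>carrier V. c \<odot>\<^bsub>W\<^esub> f x)"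
  by (simp_all add: hom_module_def)

lemma hom_module_module:
  assumes V: "module K V" and W: "module K W"
  shows "module K (hom_module K V W)"
proof -
  interpret V: module K V by fact
  interpret W: module K W by fact
  let ?H = "hom_module K V W"
  have lin: "linear_fun K V W f" if "f \<in> carrier ?H" for f
    using that by (simp add: hom_module_simps linear_maps_iff)
  have cl: "f x \<in> carrier W" if "f \<in> carrier ?H" "x \<in> carrier V" for f x
    using linear_fun_closed[OF lin[OF that(1)] that(2)] .
  have ext: "f \<in> extensional (carrier V)" if "f \<in> carrier ?H" for f
    using that by (simp add: hom_module_simps linear_maps_iff)
  have eqI: "f = g"
    if "f \<in> extensional (carrier V)" "g \<in> extensional (carrier V)"
      "\<And>x. x \<in> carrier V \<Longrightarrow> f x = g x" for f g :: "'c \<Rightarrow> 'e"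
    using that by (rule extensionalityI)
  have zero: "\<zero>\<^bsub>?H\<^esub> \<in> carrier ?H"
    unfolding hom_module_simps by (intro linear_fun_restrict V linear_fun_zero_map W)
  have add: "f \<oplus>\<^bsub>?H\<^esub> g \<in> carrier ?H" if "f \<in> carrier ?H" "g \<in> carrier ?H" for f g
    unfolding hom_module_simps by (intro linear_fun_restrict V linear_fun_sum W lin that)
  have smult: "c \<odot>\<^bsub>?H\<^esub> f \<in> carrier ?H" if "c \<in> carrier K" "f \<in> carrier ?H" for c f
    unfolding hom_module_simps by (intro linear_fun_restrict V linear_fun_scaled W lin that)
  note simps = hom_module_simps(2,3,4)
  show ?thesis
  proof (rule moduleI)
    show "abelian_group ?H"
    proof (rule abelian_groupI)
      fix f g h assume f: "f \<in> carrier ?H" and g: "g \<in> carrier ?H" and h: "h \<in> carrier ?H"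
      show "f \<oplus>\<^bsub>?H\<^esub> g \<oplus>\<^bsub>?H\<^esub> h = f \<oplus>\<^bsub>?H\<^esub> (g \<oplus>\<^bsub>?H\<^esub> h)"
        by (rule eqI) (simp_all add: simps cl f g h W.M.a_assoc)
    next
      fix f g assume f: "f \<in> carrier ?H" and g: "g \<in> carrier ?H"
      show "f \<oplus>\<^bsub>?H\<^esub> g = g \<oplus>\<^bsub>?H\<^esub> f"
        by (rule eqI) (simp_all add: simps cl f g W.M.a_comm)
    next
      fix f assume f: "f \<in> carrier ?H"
      show "\<zero>\<^bsub>?H\<^esub> \<oplus>\<^bsub>?H\<^esub> f = f"
        by (rule eqI) (simp_all add: simps cl f ext[OF f])
      have "((\<ominus>\<^bsub>K\<^esub> \<one>\<^bsub>K\<^esub>) \<odot>\<^bsub>?H\<^esub> f) \<oplus>\<^bsub>?H\<^esub> f = \<zero>\<^bsub>?H\<^esub>"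
        by (rule eqI) (simp_all add: simps cl f W.smult_l_minus W.M.l_neg)
      moreover have "(\<ominus>\<^bsub>K\<^esub> \<one>\<^bsub>K\<^esub>) \<odot>\<^bsub>?H\<^esub> f \<in> carrier ?H" using f by (intro smult) simp_all
      ultimately show "\<exists>g\<in>carrier ?H. g \<oplus>\<^bsub>?H\<^esub> f = \<zero>\<^bsub>?H\<^esub>" by blast
    qed (fact add, fact zero)
  next
    fix a b f assume a: "a \<in> carrier K" and b: "b \<in> carrier K" and f: "f \<in> carrier ?H"
    show "(a \<oplus>\<^bsub>K\<^esub> b) \<odot>\<^bsub>?H\<^esub> f = (a \<odot>\<^bsub>?H\<^esub> f) \<oplus>\<^bsub>?H\<^esub> (b \<odot>\<^bsub>?H\<^esub> f)"
      by (rule eqI) (simp_all add: simps cl a b f W.smult_l_distr)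
    show "(a \<otimes>\<^bsub>K\<^esub> b) \<odot>\<^bsub>?H\<^esub> f = a \<odot>\<^bsub>?H\<^esub> (b \<odot>\<^bsub>?H\<^esub> f)"
      by (rule eqI) (simp_all add: simps cl a b f W.smult_assoc1)
  next
    fix a f g assume a: "a \<in> carrier K" and f: "f \<in> carrier ?H" and g: "g \<in> carrier ?H"
    show "a \<odot>\<^bsub>?H\<^esub> (f \<oplus>\<^bsub>?H\<^esub> g) = (a \<odot>\<^bsub>?H\<^esub> f) \<oplus>\<^bsub>?H\<^esub> (a \<odot>\<^bsub>?H\<^esub> g)"
      by (rule eqI) (simp_all add: simps cl a f g W.smult_r_distr)
  next
    fix f assume f: "f \<in> carrier ?H"
    show "\<one>\<^bsub>K\<^esub> \<odot>\<^bsub>?H\<^esub> f = f"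
      by (rule eqI) (simp_all add: simps cl f ext[OF f])
  qed (fact V.R.cring_axioms, fact smult)
qed

section \<open>Linear functions on tensor products\<close>

lemma bilinear_map_iff:
  "bilinear_map K V W U b \<longleftrightarrow>
    (\<forall>w\<in>carrier W. linear_fun K V U (\<lambda>v. b v w)) \<and> (\<forall>v\<in>carrier V. linear_fun K W U (\<lambda>w. b v w))"
  unfolding bilinear_map_def linear_fun_def by blast

lemma bilinear_mapI:
  assumes "\<And>w. w \<in> carrier W \<Longrightarrow> linear_fun K V U (\<lambda>v. b v w)"
    and "\<And>v. v \<in> carrier V \<Longrightarrow> linear_fun K W U (\<lambda>w. b v w)"
  shows "bilinear_map K V W U b"
  using assms by (simp add: bilinear_map_iff)

text \<open>Pure tensors span, so linear functions are determined by them; this is the tool with which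
  every identity between composites below is proved.\<close>

lemma tensor_eqI:
  assumes V: "module K V" and W: "module K W"
    and f: "linear_fun K (tensor K V W) U f" and g: "linear_fun K (tensor K V W) U g"
    and eq: "\<And>v w. v \<in> carrier V \<Longrightarrow> w \<in> carrier W \<Longrightarrow>
      f (pure_tensor K V W v w) = g (pure_tensor K V W v w)"
    and x: "x \<in> carrier (tensor K V W)"
  shows "f x = g x"
proof -
  let ?T = "tensor K V W"
  have "restrict f (carrier ?T) = restrict g (carrier ?T)"
    by (rule linear_maps_agree[OF V W linear_fun_restrict[OF tensor_module[OF V W] f]
          linear_fun_restrict[OF tensor_module[OF V W] g]])
      (simp add: eq pure_tensor_closed[OF V W])
  then show ?thesis using x by (metis restrict_apply')
qed

lemma linear_fun_pure_tensor:
  assumes "module K V" and "module K W"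
  shows linear_fun_pure_tensor_left:
      "w \<in> carrier W \<Longrightarrow> linear_fun K V (tensor K V W) (\<lambda>v. pure_tensor K V W v w)"
    and linear_fun_pure_tensor_right:
      "v \<in> carrier V \<Longrightarrow> linear_fun K W (tensor K V W) (\<lambda>w. pure_tensor K V W v w)"
  using pure_tensor_bilinear[OF assms] by (simp_all add: bilinear_map_iff)

lemma linear_fun_tensor_lift:
  assumes "module K V" "module K W" "module K U" "bilinear_map K V W U b"
  shows "linear_fun K (tensor K V W) U (tensor_lift K V W U b)"
  by (rule linear_maps_linear_fun[OF tensor_lift_linear[OF assms]])

text \<open>The lift depends linearly on the bilinear map. Read in both arguments at once, this turns a
  trilinear map into a bilinear one, which is how maps out of triple tensor products arise.\<close>

lemma linear_fun_tensor_lift_family: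
  assumes U: "module K U" and V: "module K V" and W: "module K W" and T: "module K T"
    and bil: "\<And>w. w \<in> carrier W \<Longrightarrow> bilinear_map K U V T (b w)"
    and lin: "\<And>u v. u \<in> carrier U \<Longrightarrow> v \<in> carrier V \<Longrightarrow> linear_fun K W T (\<lambda>w. b w u v)"
    and x: "x \<in> carrier (tensor K U V)"
  shows "linear_fun K W T (\<lambda>w. tensor_lift K U V T (b w) x)"
proof (rule linear_funI)
  interpret W: module K W by fact
  note lift = linear_fun_tensor_lift[OF U V T bil]
    and pure = tensor_lift_pure[OF U V T bil]
  show "tensor_lift K U V T (b w) x \<in> carrier T" if "w \<in> carrier W" for w
    by (rule linear_fun_closed[OF lift[OF that] x])
  show "tensor_lift K U V T (b (w \<oplus>\<^bsub>W\<^esub> w')) x =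
      tensor_lift K U V T (b w) x \<oplus>\<^bsub>T\<^esub> tensor_lift K U V T (b w') x"
    if "w \<in> carrier W" "w' \<in> carrier W" for w w'
    by (rule tensor_eqI[where U = T, OF U V _ _ _ x])
      (simp_all add: that lift linear_fun_sum[OF T] pure linear_fun_add[OF lin])
  show "tensor_lift K U V T (b (c \<odot>\<^bsub>W\<^esub> w)) x = c \<odot>\<^bsub>T\<^esub> tensor_lift K U V T (b w) x"
    if "c \<in> carrier K" "w \<in> carrier W" for c w
    by (rule tensor_eqI[where U = T, OF U V _ _ _ x])
      (simp_all add: that lift linear_fun_scaled[OF T] pure linear_fun_smult[OF lin])
qed

lemma tensor_map_props:
  assumes V: "module K V" and W: "module K W" and V': "module K V'" and W': "module K W'"
    and f: "linear_fun K V V' f" and g: "linear_fun K W W' g"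
  shows linear_fun_tensor_map:
      "linear_fun K (tensor K V W) (tensor K V' W') (tensor_map K V W V' W' f g)"
    and tensor_map_pure: "\<lbrakk>v \<in> carrier V; w \<in> carrier W\<rbrakk> \<Longrightarrow>
      tensor_map K V W V' W' f g (pure_tensor K V W v w) = pure_tensor K V' W' (f v) (g w)"
proof -
  have bil: "bilinear_map K V W (tensor K V' W') (\<lambda>v w. pure_tensor K V' W' (f v) (g w))"
    by (intro bilinear_mapI linear_fun_comp[OF linear_fun_pure_tensor_left[OF V' W'] f]
        linear_fun_comp[OF linear_fun_pure_tensor_right[OF V' W'] g] linear_fun_closed[OF f]
        linear_fun_closed[OF g])
  show "linear_fun K (tensor K V W) (tensor K V' W') (tensor_map K V W V' W' f g)"
    unfolding tensor_map_def
    by (rule linear_fun_tensor_lift[OF V W tensor_module[OF V' W'] bil])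
  show "tensor_map K V W V' W' f g (pure_tensor K V W v w) = pure_tensor K V' W' (f v) (g w)"
    if "v \<in> carrier V" "w \<in> carrier W"
    unfolding tensor_map_def
    by (rule tensor_lift_pure[OF V W tensor_module[OF V' W'] bil that])
qed

lemma linear_fun_tensor_map_right_family:
  assumes V: "module K V" and W: "module K W" and V': "module K V'" and W': "module K W'"
    and T: "module K T" and f: "linear_fun K V V' f"
    and g: "\<And>t. t \<in> carrier T \<Longrightarrow> linear_fun K W W' (g t)"
    and g': "\<And>w. w \<in> carrier W \<Longrightarrow> linear_fun K T W' (\<lambda>t. g t w)"
    and x: "x \<in> carrier (tensor K V W)"
  shows "linear_fun K T (tensor K V' W') (\<lambda>t. tensor_map K V W V' W' f (g t) x)"
  unfolding tensor_map_def
proof (rule linear_fun_tensor_lift_family[OF V W T tensor_module[OF V' W'] _ _ x])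
  note left = linear_fun_pure_tensor_left[OF V' W'] and right = linear_fun_pure_tensor_right[OF V' W']
  show "bilinear_map K V W (tensor K V' W') (\<lambda>v w. pure_tensor K V' W' (f v) (g t w))"
    if t: "t \<in> carrier T" for t
    by (intro bilinear_mapI linear_fun_comp[OF left f] linear_fun_comp[OF right g[OF t]]
        linear_fun_closed[OF f] linear_fun_closed[OF g[OF t]])
  show "linear_fun K T (tensor K V' W') (\<lambda>t. pure_tensor K V' W' (f v) (g t w))"
    if v: "v \<in> carrier V" and w: "w \<in> carrier W" for v w
    by (rule linear_fun_comp[OF right[OF linear_fun_closed[OF f v]] g'[OF w]])
qed

lemma linear_fun_tensor_map_left_family:
  assumes V: "module K V" and W: "module K W" and V': "module K V'" and W': "module K W'"
    and T: "module K T" and g: "linear_fun K W W' g"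
    and f: "\<And>t. t \<in> carrier T \<Longrightarrow> linear_fun K V V' (f t)"
    and f': "\<And>v. v \<in> carrier V \<Longrightarrow> linear_fun K T V' (\<lambda>t. f t v)"
    and x: "x \<in> carrier (tensor K V W)"
  shows "linear_fun K T (tensor K V' W') (\<lambda>t. tensor_map K V W V' W' (f t) g x)"
  unfolding tensor_map_def
proof (rule linear_fun_tensor_lift_family[OF V W T tensor_module[OF V' W'] _ _ x])
  note left = linear_fun_pure_tensor_left[OF V' W'] and right = linear_fun_pure_tensor_right[OF V' W']
  show "bilinear_map K V W (tensor K V' W') (\<lambda>v w. pure_tensor K V' W' (f t v) (g w))"
    if t: "t \<in> carrier T" for t
    by (intro bilinear_mapI linear_fun_comp[OF left f[OF t]] linear_fun_comp[OF right g]
        linear_fun_closed[OF f[OF t]] linear_fun_closed[OF g])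
  show "linear_fun K T (tensor K V' W') (\<lambda>t. pure_tensor K V' W' (f t v) (g w))"
    if v: "v \<in> carrier V" and w: "w \<in> carrier W" for v w
    by (rule linear_fun_comp[OF left[OF linear_fun_closed[OF g w]] f'[OF v]])
qed

lemma tensor_assoc_props:
  assumes U: "module K U" and V: "module K V" and W: "module K W"
  shows linear_fun_tensor_assoc:
      "linear_fun K (tensor K (tensor K U V) W) (tensor K U (tensor K V W)) (tensor_assoc K U V W)"
    and tensor_assoc_pure: "\<lbrakk>u \<in> carrier U; v \<in> carrier V; w \<in> carrier W\<rbrakk> \<Longrightarrow>
      tensor_assoc K U V W (pure_tensor K (tensor K U V) W (pure_tensor K U V u v) w) =
        pure_tensor K U (tensor K V W) u (pure_tensor K V W v w)"
proof -
  let ?VW = "tensor K V W" and ?UV = "tensor K U V"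
  let ?T = "tensor K U ?VW"
  let ?b = "\<lambda>w u v. pure_tensor K U ?VW u (pure_tensor K V W v w)"
  note VW = tensor_module[OF V W] and UV = tensor_module[OF U V]
  note T = tensor_module[OF U VW]
  have inner: "bilinear_map K U V ?T (?b w)" if "w \<in> carrier W" for w
    using that
    by (intro bilinear_mapI linear_fun_pure_tensor_left[OF U VW] pure_tensor_closed[OF V W]
        linear_fun_comp[OF linear_fun_pure_tensor_right[OF U VW]] linear_fun_pure_tensor_left[OF V W])
  have outer: "bilinear_map K ?UV W ?T (\<lambda>x w. tensor_lift K U V ?T (?b w) x)"
    by (intro bilinear_mapI linear_fun_tensor_lift[OF U V T] inner
        linear_fun_tensor_lift_family[OF U V W T]
        linear_fun_comp[OF linear_fun_pure_tensor_right[OF U VW]] linear_fun_pure_tensor_right[OF V W])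
  show "linear_fun K (tensor K ?UV W) ?T (tensor_assoc K U V W)"
    unfolding tensor_assoc_def Let_def by (rule linear_fun_tensor_lift[OF UV W T outer])
  show "tensor_assoc K U V W (pure_tensor K ?UV W (pure_tensor K U V u v) w) = ?b w u v"
    if "u \<in> carrier U" "v \<in> carrier V" "w \<in> carrier W"
    unfolding tensor_assoc_def Let_def
    using that by (simp add: tensor_lift_pure[OF UV W T outer] tensor_lift_pure[OF U V T inner]
        pure_tensor_closed[OF U V])
qed

lemma tensor_assoc_inv_props:
  assumes U: "module K U" and V: "module K V" and W: "module K W"
  shows linear_fun_tensor_assoc_inv:
      "linear_fun K (tensor K U (tensor K V W)) (tensor K (tensor K U V) W) (tensor_assoc_inv K U V W)"
    and tensor_assoc_inv_pure: "\<lbrakk>u \<in> carrier U; v \<in> carrier V; w \<in> carrier W\<rbrakk> \<Longrightarrow>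
      tensor_assoc_inv K U V W (pure_tensor K U (tensor K V W) u (pure_tensor K V W v w)) =
        pure_tensor K (tensor K U V) W (pure_tensor K U V u v) w"
proof -
  let ?VW = "tensor K V W" and ?UV = "tensor K U V"
  let ?T = "tensor K ?UV W"
  let ?b = "\<lambda>u v w. pure_tensor K ?UV W (pure_tensor K U V u v) w"
  note VW = tensor_module[OF V W] and UV = tensor_module[OF U V]
  note T = tensor_module[OF UV W]
  have inner: "bilinear_map K V W ?T (?b u)" if "u \<in> carrier U" for u
    using that
    by (intro bilinear_mapI linear_fun_pure_tensor_right[OF UV W] pure_tensor_closed[OF U V]
        linear_fun_comp[OF linear_fun_pure_tensor_left[OF UV W]] linear_fun_pure_tensor_right[OF U V])
  have outer: "bilinear_map K U ?VW ?T (\<lambda>u y. tensor_lift K V W ?T (?b u) y)"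
    by (intro bilinear_mapI linear_fun_tensor_lift[OF V W T] inner
        linear_fun_tensor_lift_family[OF V W U T]
        linear_fun_comp[OF linear_fun_pure_tensor_left[OF UV W]] linear_fun_pure_tensor_left[OF U V])
  show "linear_fun K (tensor K U ?VW) ?T (tensor_assoc_inv K U V W)"
    unfolding tensor_assoc_inv_def Let_def by (rule linear_fun_tensor_lift[OF U VW T outer])
  show "tensor_assoc_inv K U V W (pure_tensor K U ?VW u (pure_tensor K V W v w)) = ?b u v w"
    if "u \<in> carrier U" "v \<in> carrier V" "w \<in> carrier W"
    unfolding tensor_assoc_inv_def Let_def
    using that by (simp add: tensor_lift_pure[OF U VW T outer] tensor_lift_pure[OF V W T inner]
        pure_tensor_closed[OF V W])
qed

section \<open>The bimodule structure on the tensor square\<close>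

definition left_act ::
    "('k, 'm) ring_scheme \<Rightarrow> ('k, 'a, 'p) module_scheme \<Rightarrow> 'a \<Rightarrow> ('a \<times> 'a \<Rightarrow> 'k) set \<Rightarrow> ('a \<times> 'a \<Rightarrow> 'k) set"
  where "left_act K A x = tensor_map K A A A A (\<lambda>p. x \<otimes>\<^bsub>A\<^esub> p) id"

definition right_act ::
    "('k, 'm) ring_scheme \<Rightarrow> ('k, 'a, 'p) module_scheme \<Rightarrow> ('a \<times> 'a \<Rightarrow> 'k) set \<Rightarrow> 'a \<Rightarrow> ('a \<times> 'a \<Rightarrow> 'k) set"
  where "right_act K A s y = tensor_map K A A A A id (\<lambda>q. q \<otimes>\<^bsub>A\<^esub> y) s"

definition bimodule_map ::
    "('k, 'm) ring_scheme \<Rightarrow> ('k, 'a, 'p) module_scheme \<Rightarrow> ('a \<Rightarrow> ('a \<times> 'a \<Rightarrow> 'k) set) \<Rightarrow> bool"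
  where "bimodule_map K A D \<longleftrightarrow>
    (\<forall>x\<in>carrier A. \<forall>y\<in>carrier A.
      D (x \<otimes>\<^bsub>A\<^esub> y) = right_act K A (D x) y \<and> D (x \<otimes>\<^bsub>A\<^esub> y) = left_act K A x (D y))"

lemma bimodule_mapI:
  assumes "\<And>x y. x \<in> carrier A \<Longrightarrow> y \<in> carrier A \<Longrightarrow> D (x \<otimes>\<^bsub>A\<^esub> y) = right_act K A (D x) y"
    and "\<And>x y. x \<in> carrier A \<Longrightarrow> y \<in> carrier A \<Longrightarrow> D (x \<otimes>\<^bsub>A\<^esub> y) = left_act K A x (D y)"
  shows "bimodule_map K A D"
  using assms unfolding bimodule_map_def by blast

lemma bimodule_mapD:
  assumes "bimodule_map K A D" and "x \<in> carrier A" and "y \<in> carrier A"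
  shows bimodule_map_right: "D (x \<otimes>\<^bsub>A\<^esub> y) = right_act K A (D x) y"
    and bimodule_map_left: "D (x \<otimes>\<^bsub>A\<^esub> y) = left_act K A x (D y)"
  using assms unfolding bimodule_map_def by blast+

context
  fixes K :: "('k, 'm) ring_scheme" and A :: "('k, 'a, 'p) module_scheme"
  assumes alg: "assoc_algebra K A"
begin

interpretation A: ring A using alg by (simp add: assoc_algebra_def)
interpretation M: module K A using alg by (simp add: assoc_algebra_def)

private abbreviation AA where "AA \<equiv> tensor K A A"
private abbreviation A_AA where "A_AA \<equiv> tensor K A AA"
private abbreviation AA_A where "AA_A \<equiv> tensor K AA A"

private lemma mod: "module K A" "module K AA" "module K A_AA" "module K AA_A"
  by (intro tensor_module M.module_axioms)+

private lemmas pure_closed =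
  pure_tensor_closed[OF mod(1,1)] pure_tensor_closed[OF mod(1,2)] pure_tensor_closed[OF mod(2,1)]

lemma linear_fun_mult_left: "x \<in> carrier A \<Longrightarrow> linear_fun K A A (\<lambda>y. x \<otimes>\<^bsub>A\<^esub> y)"
  using assoc_algebra.smult_mult_right[OF alg] by (intro linear_funI) (simp_all add: A.r_distr)

lemma linear_fun_mult_right: "y \<in> carrier A \<Longrightarrow> linear_fun K A A (\<lambda>x. x \<otimes>\<^bsub>A\<^esub> y)"
  using assoc_algebra.smult_mult_left[OF alg] by (intro linear_funI) (simp_all add: A.l_distr)

private lemma mult_bilinear: "bilinear_map K A A A (\<lambda>x y. x \<otimes>\<^bsub>A\<^esub> y)"
  by (intro bilinear_mapI linear_fun_mult_left linear_fun_mult_right)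

lemma linear_fun_mult_map: "linear_fun K AA A (mult_map K A)"
  unfolding mult_map_def by (intro linear_fun_tensor_lift mod mult_bilinear)

lemma mult_map_pure:
  "\<lbrakk>x \<in> carrier A; y \<in> carrier A\<rbrakk> \<Longrightarrow> mult_map K A (pure_tensor K A A x y) = x \<otimes>\<^bsub>A\<^esub> y"
  unfolding mult_map_def by (rule tensor_lift_pure[OF mod(1,1,1) mult_bilinear])

lemma linear_fun_left_act: "x \<in> carrier A \<Longrightarrow> linear_fun K AA AA (left_act K A x)"
  unfolding left_act_def by (intro linear_fun_tensor_map mod linear_fun_mult_left linear_fun_id)

lemma linear_fun_left_act_scalar:
  "s \<in> carrier AA \<Longrightarrow> linear_fun K A AA (\<lambda>x. left_act K A x s)"
  unfolding left_act_def
  by (intro linear_fun_tensor_map_left_family mod linear_fun_mult_left linear_fun_mult_right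
      linear_fun_id)

lemma left_act_pure:
  "\<lbrakk>x \<in> carrier A; p \<in> carrier A; q \<in> carrier A\<rbrakk> \<Longrightarrow>
    left_act K A x (pure_tensor K A A p q) = pure_tensor K A A (x \<otimes>\<^bsub>A\<^esub> p) q"
  unfolding left_act_def
  by (simp add: tensor_map_pure[OF mod(1,1,1,1) linear_fun_mult_left linear_fun_id])

lemma linear_fun_right_act: "y \<in> carrier A \<Longrightarrow> linear_fun K AA AA (\<lambda>s. right_act K A s y)"
  unfolding right_act_def by (intro linear_fun_tensor_map mod linear_fun_mult_right linear_fun_id)

lemma right_act_pure:
  "\<lbrakk>y \<in> carrier A; p \<in> carrier A; q \<in> carrier A\<rbrakk> \<Longrightarrow>
    right_act K A (pure_tensor K A A p q) y = pure_tensor K A A p (q \<otimes>\<^bsub>A\<^esub> y)"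
  unfolding right_act_def
  by (simp add: tensor_map_pure[OF mod(1,1,1,1) linear_fun_id linear_fun_mult_right])

section \<open>Nearly Frobenius coproducts are the bimodule maps\<close>

text \<open>For \<open>s = p \<otimes> q\<close> both sides are \<open>p \<otimes> q y\<close>, and for the mirror image below
  both are \<open>x p \<otimes> q\<close>.\<close>

lemma mult_assoc_eq_right_act:
  assumes s: "s \<in> carrier AA" and y: "y \<in> carrier A"
  shows "tensor_map K A AA A A id (mult_map K A) (tensor_assoc K A A A (pure_tensor K AA A s y)) =
    right_act K A s y"
proof (rule tensor_eqI[OF mod(1,1) _ _ _ s])
  show "linear_fun K AA AA (\<lambda>s. tensor_map K A AA A A id (mult_map K A)
      (tensor_assoc K A A A (pure_tensor K AA A s y)))"
    by (intro linear_fun_comp[OF linear_fun_tensor_map] linear_fun_comp[OF linear_fun_tensor_assoc]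
        linear_fun_pure_tensor_left mod linear_fun_id linear_fun_mult_map y)
  fix p q assume "p \<in> carrier A" "q \<in> carrier A"
  then show "tensor_map K A AA A A id (mult_map K A)
      (tensor_assoc K A A A (pure_tensor K AA A (pure_tensor K A A p q) y)) =
    right_act K A (pure_tensor K A A p q) y"
    using y by (simp add: tensor_assoc_pure[OF mod(1,1,1)] right_act_pure mult_map_pure pure_closed
        tensor_map_pure[OF mod(1,2,1,1) linear_fun_id linear_fun_mult_map])
qed (rule linear_fun_right_act[OF y])

lemma mult_assoc_inv_eq_left_act:
  assumes s: "s \<in> carrier AA" and x: "x \<in> carrier A"
  shows "tensor_map K AA A A A (mult_map K A) id (tensor_assoc_inv K A A A (pure_tensor K A AA x s)) =
    left_act K A x s"
proof (rule tensor_eqI[OF mod(1,1) _ _ _ s])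
  show "linear_fun K AA AA (\<lambda>s. tensor_map K AA A A A (mult_map K A) id
      (tensor_assoc_inv K A A A (pure_tensor K A AA x s)))"
    by (intro linear_fun_comp[OF linear_fun_tensor_map] linear_fun_comp[OF linear_fun_tensor_assoc_inv]
        linear_fun_pure_tensor_right mod linear_fun_id linear_fun_mult_map x)
  fix p q assume "p \<in> carrier A" "q \<in> carrier A"
  then show "tensor_map K AA A A A (mult_map K A) id
      (tensor_assoc_inv K A A A (pure_tensor K A AA x (pure_tensor K A A p q))) =
    left_act K A x (pure_tensor K A A p q)"
    using x by (simp add: tensor_assoc_inv_pure[OF mod(1,1,1)] left_act_pure mult_map_pure pure_closed
        tensor_map_pure[OF mod(2,1,1,1) linear_fun_mult_map linear_fun_id])
qed (rule linear_fun_left_act[OF x])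

text \<open>The two equations on \<open>A \<otimes> A\<close> say, on a pure tensor \<open>x \<otimes> y\<close>, that \<open>D (x y)\<close> is
  \<open>D x \<cdot> y\<close> and \<open>x \<cdot> D y\<close>.\<close>

lemma bimodule_map_iff_tensor_equations:
  assumes D: "linear_fun K A AA D"
  shows "bimodule_map K A D \<longleftrightarrow>
    (\<forall>t\<in>carrier AA. D (mult_map K A t) =
      tensor_map K A AA A A id (mult_map K A) (tensor_assoc K A A A (tensor_map K A A AA A D id t))) \<and>
    (\<forall>t\<in>carrier AA. D (mult_map K A t) =
      tensor_map K AA A A A (mult_map K A) id (tensor_assoc_inv K A A A (tensor_map K A A A AA id D t)))"
    (is "_ \<longleftrightarrow> (\<forall>t\<in>_. D (?m t) = ?R t) \<and> (\<forall>t\<in>_. D (?m t) = ?L t)")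
proof -
  have lin: "linear_fun K AA AA (\<lambda>t. D (?m t))" "linear_fun K AA AA ?R" "linear_fun K AA AA ?L"
    by (intro linear_fun_comp[OF D linear_fun_mult_map]
        linear_fun_comp[OF linear_fun_tensor_map] linear_fun_comp[OF linear_fun_tensor_assoc]
        linear_fun_comp[OF linear_fun_tensor_assoc_inv] linear_fun_tensor_map
        mod linear_fun_id linear_fun_mult_map D)+
  have R: "?R (pure_tensor K A A x y) = right_act K A (D x) y"
    and L: "?L (pure_tensor K A A x y) = left_act K A x (D y)"
    if "x \<in> carrier A" "y \<in> carrier A" for x y
    using that by (simp_all add: tensor_map_pure[OF mod(1,1,2,1) D linear_fun_id]
        tensor_map_pure[OF mod(1,1,1,2) linear_fun_id D] linear_fun_closed[OF D]
        mult_assoc_eq_right_act mult_assoc_inv_eq_left_act)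
  show ?thesis
  proof
    assume B: "bimodule_map K A D"
    have "D (?m t) = ?R t" if "t \<in> carrier AA" for t
      by (rule tensor_eqI[OF mod(1,1) lin(1,2) _ that])
        (simp add: R mult_map_pure bimodule_map_right[OF B])
    moreover have "D (?m t) = ?L t" if "t \<in> carrier AA" for t
      by (rule tensor_eqI[OF mod(1,1) lin(1,3) _ that])
        (simp add: L mult_map_pure bimodule_map_left[OF B])
    ultimately show "(\<forall>t\<in>carrier AA. D (?m t) = ?R t) \<and> (\<forall>t\<in>carrier AA. D (?m t) = ?L t)"
      by blast
  next
    assume eqs: "(\<forall>t\<in>carrier AA. D (?m t) = ?R t) \<and> (\<forall>t\<in>carrier AA. D (?m t) = ?L t)"
    show "bimodule_map K A D"
    proof (rule bimodule_mapI)
      fix x y assume x: "x \<in> carrier A" and y: "y \<in> carrier A"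
      note xy = pure_closed(1)[OF x y]
      show "D (x \<otimes>\<^bsub>A\<^esub> y) = right_act K A (D x) y"
        using bspec[OF conjunct1[OF eqs] xy] by (simp only: mult_map_pure[OF x y] R[OF x y])
      show "D (x \<otimes>\<^bsub>A\<^esub> y) = left_act K A x (D y)"
        using bspec[OF conjunct2[OF eqs] xy] by (simp only: mult_map_pure[OF x y] L[OF x y])
    qed
  qed
qed

text \<open>For \<open>s = \<Sum> p\<^sub>i \<otimes> q\<^sub>i\<close> both sides are \<open>\<Sum> p\<^sub>i \<otimes> (q\<^sub>i z \<otimes> w)\<close>; the left side is
  \<open>(D \<otimes> 1) (z \<otimes> w)\<close> when \<open>s = D 1\<close> for a
  bimodule map \<open>D\<close>, and the right side depends only on the tensor \<open>z \<otimes> w\<close>.\<close>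

lemma assoc_right_act_pure:
  assumes s: "s \<in> carrier AA" and z: "z \<in> carrier A" and w: "w \<in> carrier A"
  shows "tensor_assoc K A A A (pure_tensor K AA A (right_act K A s z) w) =
    tensor_map K A A A AA id (\<lambda>y. left_act K A y (pure_tensor K A A z w)) s"
proof (rule tensor_eqI[OF mod(1,1) _ _ _ s])
  note zw = linear_fun_left_act_scalar[OF pure_closed(1)[OF z w]]
  show "linear_fun K AA A_AA (\<lambda>s. tensor_assoc K A A A (pure_tensor K AA A (right_act K A s z) w))"
    by (intro linear_fun_comp[OF linear_fun_tensor_assoc]
        linear_fun_comp[OF linear_fun_pure_tensor_left] linear_fun_right_act mod z w)
  show "linear_fun K AA A_AA
      (tensor_map K A A A AA id (\<lambda>y. left_act K A y (pure_tensor K A A z w)))"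
    by (intro linear_fun_tensor_map mod linear_fun_id zw)
  fix p q assume "p \<in> carrier A" "q \<in> carrier A"
  then show "tensor_assoc K A A A
        (pure_tensor K AA A (right_act K A (pure_tensor K A A p q) z) w) =
      tensor_map K A A A AA id (\<lambda>y. left_act K A y (pure_tensor K A A z w)) (pure_tensor K A A p q)"
    using z w by (simp add: right_act_pure left_act_pure tensor_assoc_pure[OF mod(1,1,1)]
        tensor_map_pure[OF mod(1,1,1,2) linear_fun_id zw])
qed

text \<open>Both sides of the coassociativity law become \<open>\<Sum> p\<^sub>i \<otimes> (q\<^sub>i \<cdot> D a)\<close>, where
  \<open>D 1 = \<Sum> p\<^sub>i \<otimes> q\<^sub>i\<close>. The unit of \<open>A\<close> is what makes \<open>D 1\<close> available.\<close>

lemma bimodule_map_coassociative: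
  assumes D: "linear_fun K A AA D" and B: "bimodule_map K A D" and a: "a \<in> carrier A"
  shows "tensor_assoc K A A A (tensor_map K A A AA A D id (D a)) = tensor_map K A A A AA id D (D a)"
proof -
  define u where "u = D \<one>\<^bsub>A\<^esub>"
  have u: "u \<in> carrier AA" unfolding u_def using D by (rule linear_fun_closed) simp
  have Da: "D a \<in> carrier AA" by (rule linear_fun_closed[OF D a])
  have Du: "D z = right_act K A u z" if "z \<in> carrier A" for z
  proof -
    have "D z = D (\<one>\<^bsub>A\<^esub> \<otimes>\<^bsub>A\<^esub> z)" using that by simp
    also have "\<dots> = right_act K A u z"
      unfolding u_def by (rule bimodule_map_right[OF B A.one_closed that])
    finally show ?thesis .
  qed
  have left: "D (y \<otimes>\<^bsub>A\<^esub> a) = left_act K A y (D a)" if "y \<in> carrier A" for y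
    by (rule bimodule_map_left[OF B that a])
  have "tensor_assoc K A A A (tensor_map K A A AA A D id (D a)) =
      tensor_map K A A A AA id (\<lambda>y. left_act K A y (D a)) u"
  proof (rule tensor_eqI[OF mod(1,1) _ _ _ Da])
    show "linear_fun K AA A_AA (\<lambda>t. tensor_assoc K A A A (tensor_map K A A AA A D id t))"
      by (intro linear_fun_comp[OF linear_fun_tensor_assoc] linear_fun_tensor_map mod linear_fun_id D)
    show "linear_fun K AA A_AA (\<lambda>t. tensor_map K A A A AA id (\<lambda>y. left_act K A y t) u)"
      by (intro linear_fun_tensor_map_right_family mod linear_fun_id linear_fun_left_act
          linear_fun_left_act_scalar u)
    fix z w assume zw: "z \<in> carrier A" "w \<in> carrier A"
    then show "tensor_assoc K A A A (tensor_map K A A AA A D id (pure_tensor K A A z w)) =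
        tensor_map K A A A AA id (\<lambda>y. left_act K A y (pure_tensor K A A z w)) u"
      by (simp add: tensor_map_pure[OF mod(1,1,2,1) D linear_fun_id] Du assoc_right_act_pure[OF u])
  qed
  also have "\<dots> = tensor_map K A A A AA id D (right_act K A u a)"
  proof (rule tensor_eqI[OF mod(1,1) _ _ _ u])
    note lDa = linear_fun_left_act_scalar[OF Da]
    show "linear_fun K AA A_AA (tensor_map K A A A AA id (\<lambda>y. left_act K A y (D a)))"
      by (intro linear_fun_tensor_map mod linear_fun_id lDa)
    show "linear_fun K AA A_AA (\<lambda>s. tensor_map K A A A AA id D (right_act K A s a))"
      by (intro linear_fun_comp[OF linear_fun_tensor_map] linear_fun_right_act mod linear_fun_id D a)
    fix p q assume "p \<in> carrier A" "q \<in> carrier A"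
    then show "tensor_map K A A A AA id (\<lambda>y. left_act K A y (D a)) (pure_tensor K A A p q) =
        tensor_map K A A A AA id D (right_act K A (pure_tensor K A A p q) a)"
      using a by (simp add: right_act_pure left tensor_map_pure[OF mod(1,1,1,2) linear_fun_id D]
          tensor_map_pure[OF mod(1,1,1,2) linear_fun_id lDa])
  qed
  also have "\<dots> = tensor_map K A A A AA id D (D a)"
    by (simp only: Du[OF a])
  finally show ?thesis .
qed

theorem nearly_frobenius_iff_bimodule_map:
  "nearly_frobenius_coproduct K A D \<longleftrightarrow> D \<in> linear_maps K A AA \<and> bimodule_map K A D"
proof (cases "D \<in> linear_maps K A AA")
  case True
  note D = linear_maps_linear_fun[OF True]
  show ?thesis
    unfolding nearly_frobenius_coproduct_def Let_def bimodule_map_iff_tensor_equations[OF D, symmetric]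
    using True bimodule_map_coassociative[OF D] by (metis (no_types, lifting))
qed (simp add: nearly_frobenius_coproduct_def Let_def)

section \<open>The space of coproducts\<close>

lemma nearly_frobenius_submodule:
  "submodule {D. nearly_frobenius_coproduct K A D} K (hom_module K A AA)"
proof -
  let ?H = "hom_module K A AA"
  let ?E = "{D. nearly_frobenius_coproduct K A D}"
  interpret H: module K ?H by (intro hom_module_module mod)
  have EI: "D \<in> ?E" if "D \<in> carrier ?H" "bimodule_map K A D" for D
    using that by (simp add: nearly_frobenius_iff_bimodule_map hom_module_simps)
  have EH: "D \<in> carrier ?H" and B: "bimodule_map K A D" and lin: "linear_fun K A AA D"
    if "D \<in> ?E" for D
    using that by (auto simp: nearly_frobenius_iff_bimodule_map hom_module_simps linear_maps_iff)
  note acts = linear_fun_right_act linear_fun_left_act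
  have smult: "c \<odot>\<^bsub>?H\<^esub> D \<in> ?E" if c: "c \<in> carrier K" and D: "D \<in> ?E" for c D
  proof (rule EI)
    show "c \<odot>\<^bsub>?H\<^esub> D \<in> carrier ?H" using c EH[OF D] by (rule H.smult_closed)
    show "bimodule_map K A (c \<odot>\<^bsub>?H\<^esub> D)"
    proof (rule bimodule_mapI)
      fix x y assume xy: "x \<in> carrier A" "y \<in> carrier A"
      note simps = c xy hom_module_simps linear_fun_closed[OF lin[OF D]]
      show "(c \<odot>\<^bsub>?H\<^esub> D) (x \<otimes>\<^bsub>A\<^esub> y) = right_act K A ((c \<odot>\<^bsub>?H\<^esub> D) x) y"
        by (simp add: simps bimodule_map_right[OF B[OF D]] linear_fun_smult[OF linear_fun_right_act])
      show "(c \<odot>\<^bsub>?H\<^esub> D) (x \<otimes>\<^bsub>A\<^esub> y) = left_act K A x ((c \<odot>\<^bsub>?H\<^esub> D) y)"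
        by (simp add: simps bimodule_map_left[OF B[OF D]] linear_fun_smult[OF linear_fun_left_act])
    qed
  qed
  show ?thesis
  proof (rule H.submoduleI)
    show "?E \<subseteq> carrier ?H" using EH by blast
    show "\<zero>\<^bsub>?H\<^esub> \<in> ?E"
    proof (rule EI)
      show "bimodule_map K A \<zero>\<^bsub>?H\<^esub>"
        by (simp add: bimodule_map_def hom_module_simps acts[THEN linear_fun_zero[OF mod(2,2)]])
    qed simp
    show "D \<oplus>\<^bsub>?H\<^esub> D' \<in> ?E" if D: "D \<in> ?E" and D': "D' \<in> ?E" for D D'
    proof (rule EI)
      show "D \<oplus>\<^bsub>?H\<^esub> D' \<in> carrier ?H" using EH[OF D] EH[OF D'] by (rule H.a_closed)
      show "bimodule_map K A (D \<oplus>\<^bsub>?H\<^esub> D')"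
      proof (rule bimodule_mapI)
        fix x y assume xy: "x \<in> carrier A" "y \<in> carrier A"
        note simps = xy hom_module_simps linear_fun_closed[OF lin[OF D]] linear_fun_closed[OF lin[OF D']]
        show "(D \<oplus>\<^bsub>?H\<^esub> D') (x \<otimes>\<^bsub>A\<^esub> y) = right_act K A ((D \<oplus>\<^bsub>?H\<^esub> D') x) y"
          by (simp add: simps bimodule_map_right[OF B[OF D]] bimodule_map_right[OF B[OF D']]
              linear_fun_add[OF linear_fun_right_act])
        show "(D \<oplus>\<^bsub>?H\<^esub> D') (x \<otimes>\<^bsub>A\<^esub> y) = left_act K A x ((D \<oplus>\<^bsub>?H\<^esub> D') y)"
          by (simp add: simps bimodule_map_left[OF B[OF D]] bimodule_map_left[OF B[OF D']]
              linear_fun_add[OF linear_fun_left_act])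
      qed
    qed
    show "\<ominus>\<^bsub>?H\<^esub> D \<in> ?E" if D: "D \<in> ?E" for D
    proof -
      have "\<ominus>\<^bsub>?H\<^esub> D = (\<ominus>\<^bsub>K\<^esub> \<one>\<^bsub>K\<^esub>) \<odot>\<^bsub>?H\<^esub> D"
        using EH[OF D] by (simp only: H.smult_l_minus M.R.one_closed H.smult_one)
      then show ?thesis using smult[OF _ D] by simp
    qed
  qed (fact smult)
qed

end

theorem theorem2p3:
  fixes K :: "('k, 'm) ring_scheme" and A :: "('k, 'a, 'p) module_scheme"
  assumes "field K" and "assoc_algebra K A"
  shows "vectorspace K (coproduct_space K A)"
proof -
  have A: "module K A" using assms(2) by (simp add: assoc_algebra_def)
  have "module K (hom_module K A (tensor K A A))"
    by (intro hom_module_module tensor_module A)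
  then have "module K (coproduct_space K A)"
    unfolding coproduct_space_def
    by (rule submodule.submodule_is_module[OF nearly_frobenius_submodule[OF assms(2)]])
  with assms(1) show ?thesis by (rule vectorspace.intro)
qed

end
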